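(* Let $X_1,\ldots,X_n$ be i.i.d. random variables on $T=[0,1]$ or $T=\mathbb R$ with density $f\in\mathcal P_n(L_0)$ and suppose $B,r,R$ and $0<\alpha<1$ are given. Then, if $L_0$ is large enough depending only on $B$, a confidence band $C_n=C_n(B,r,R,\alpha;X_1,\ldots,X_n)$ can be constructed such that $$\liminf_n\inf_{f\in\mathcal P_n(L_0)}\Pr\nolimits_f(f\in C_n)\ge1-\alpha$$ and, for every $s\in\mathcal S_n$, $n\in\mathbb N$ and some constant $L'$ independent of $n$, $$\sup_{f\in\tilde\Sigma_n(s)}E_f|C_n|\le L'r_n(s).$$
   Context: $\Pr_f$ and $E_f$ denote the joint law of $X_1,\ldots,X_n$ and the corresponding expectation when the density is $f$. $\|\cdot\|_\infty$ is the supremum norm on $T$. $B\ge1$ and $0<r<R<\infty$. Hölder norm: fix an $S$-regular Daubechies wavelet basis of $L^2(T)$, $S>R$ (boundary-corrected if $T=[0,1]$), with compactly supported, $S$ times continuously differentiable scaling functions $\phi_k$ and wavelets $\psi_k$, $\psi_{lk}=2^{l/2}\psi_k(2^l\cdot)$; if $T=\mathbb R$, $l\ge0$ and $k\in\mathbb Z$; if $T=[0,1]$, $l\ge J_0$, $k=1,\ldots,2^l$ for the $\psi_{lk}$ and $k=1,\ldots,N$ for the $\phi_k$. For bounded continuous $f$ put $\alpha_k(f)=\int f\phi_k$, $\beta_{lk}(f)=\int f\psi_{lk}$ and $\|f\|_{s,\infty}=\max\bigl(\sup_k|\alpha_k(f)|,\ \sup_{k,l}2^{l(s+1/2)}|\beta_{lk}(f)|\bigr)$.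 $\Sigma(s)=\Sigma(s,B,T)=\{f:T\to[0,\infty)\text{ bounded continuous},\ \int_Tf=1,\ \|f\|_{s,\infty}\le B\}$. Rate: $r_n(s)=(\log n/n)^{s/(2s+1)}$. Grid: for a fixed constant $\zeta>0$, $\mathcal S_n=\mathcal S_n(\zeta)=\{s_i:\ i=1,\ldots,|\mathcal S_n|\}\subset[r,R]$ with $s_1=r$, $s_{|\mathcal S_n|}=R$, $s_i<s_{i+1}$, and each point having distance at most $2\zeta/\log n$ and at least $\zeta/\log n$ to the next point; thus $|\mathcal S_n|$ is of order $\log n$. Here $n$ is understood to range over those integers $n\ge2$ for which such a grid exists (all sufficiently large $n$). Classes: for $L_0>0$ and $s\in\mathcal S_n$, $s<R$, $\tilde\Sigma_n(s)=\{f\in\Sigma(s):\ \inf_{g\in\Sigma(t)}\|g-f\|_\infty\ge L_0r_n(s)\ \text{for all } t\in\mathcal S_n,\ t>s\}$; $\tilde\Sigma_n(R)=\Sigma(R)$; and $\mathcal P_n(L_0)=\bigcup_{s\in\mathcal S_n}\tilde\Sigma_n(s)$. Confidence band: $C_n=C_n(X_1,\ldots,X_n)$ is a family of random intervals $\{C_n(y)=[c_n(y),c_n'(y)]\}_{y\in T}$ with maximal diameter $|C_n|=\sup_{y\in T}|c_n'(y)-c_n(y)|$. $\{f\in C_n\}$ means $f(y)\in C_n(y)$ for all $y\in T$.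
   Formalization: The threshold for L_0 may depend on r (and on T and the fixed wavelet basis) as well as on B, not on B only; it stays independent of R, ζ and α. A threshold uniform over all r>0 would make the claim false, since perturbations spread over about 1/r levels cannot be detected. *)

theory Defs
  imports "HOL-Probability.Probability"
begin

section \<open>Compactly supported wavelets\<close>

definition times_cont_diff_on :: "nat \<Rightarrow> real set \<Rightarrow> (real \<Rightarrow> real) \<Rightarrow> bool" where
  "times_cont_diff_on S A f \<longleftrightarrow>
     (\<exists>D :: nat \<Rightarrow> real \<Rightarrow> real.
        (\<forall>x\<in>A. D 0 x = f x) \<and>
        (\<forall>i<S. \<forall>x\<in>A. (D i has_real_derivative D (Suc i) x) (at x within A)) \<and>
        (\<forall>i\<le>S. continuous_on A (D i)))"

text \<open>
  Daubechies' orthonormal filters of order \<open>N\<close>: length \<open>2 N\<close> (here placed on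
  \<open>1 - N, \<dots>, N\<close>) and \<open>N\<close> vanishing moments. All spectral factorisations are
  admitted, so the extremal phase filters and the least asymmetric ones are both covered.
\<close>

definition daubechies_filter :: "nat \<Rightarrow> (int \<Rightarrow> real) \<Rightarrow> bool" where
  "daubechies_filter N h \<longleftrightarrow>
     N \<ge> 1 \<and>
     (\<forall>k. k \<notin> {1 - int N..int N} \<longrightarrow> h k = 0) \<and>
     (\<Sum>k\<in>{1 - int N..int N}. h k) = sqrt 2 \<and>
     (\<forall>m. (\<Sum>k\<in>{1 - int N..int N}. h k * h (k + 2 * m)) = (if m = 0 then 1 else 0)) \<and>
     (\<forall>p<N. (\<Sum>k\<in>{1 - int N..int N}. (-1) powi k * of_int k ^ p * h k) = 0)"

text \<open>
  Scaling function \<open>u\<close> and mother wavelet \<open>w\<close> of a filter of order \<open>N\<close>; both are then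
  supported in \<open>[1 - N, N]\<close>.
\<close>

definition daubechies_pair :: "nat \<Rightarrow> nat \<Rightarrow> (real \<Rightarrow> real) \<Rightarrow> (real \<Rightarrow> real) \<Rightarrow> bool" where
  "daubechies_pair S N u w \<longleftrightarrow>
     (\<exists>h. daubechies_filter N h \<and>
        (\<forall>x. x \<notin> {1 - real N..real N} \<longrightarrow> u x = 0) \<and>
        times_cont_diff_on S UNIV u \<and>
        times_cont_diff_on S UNIV w \<and>
        (LINT x|lborel. u x) = 1 \<and>
        (\<forall>x. u x = sqrt 2 * (\<Sum>k\<in>{1 - int N..int N}. h k * u (2 * x - of_int k))) \<and>
        (\<forall>x. w x = sqrt 2 *
           (\<Sum>k\<in>{1 - int N..int N}. (-1) powi k * h (1 - k) * u (2 * x - of_int k))))"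

record wavelet_system =
  scal :: "int \<Rightarrow> real \<Rightarrow> real"
  scal_ix :: "int set"
  wav :: "nat \<Rightarrow> int \<Rightarrow> real \<Rightarrow> real"
  base_level :: nat
  wav_ix :: "nat \<Rightarrow> int set"

definition orthonormal_on :: "real set \<Rightarrow> 'i set \<Rightarrow> ('i \<Rightarrow> real \<Rightarrow> real) \<Rightarrow> bool" where
  "orthonormal_on T I e \<longleftrightarrow>
     (\<forall>i\<in>I. set_borel_measurable lborel T (e i)) \<and>
     (\<forall>i\<in>I. \<forall>j\<in>I. (LINT x:T|lborel. e i x * e j x) = (if i = j then 1 else 0))"

definition orthonormal_basis_on :: "real set \<Rightarrow> 'i set \<Rightarrow> ('i \<Rightarrow> real \<Rightarrow> real) \<Rightarrow> bool" where
  "orthonormal_basis_on T I e \<longleftrightarrow>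
     orthonormal_on T I e \<and>
     (\<forall>f. set_borel_measurable lborel T f \<longrightarrow> set_integrable lborel T (\<lambda>x. (f x)\<^sup>2) \<longrightarrow>
          (\<forall>i\<in>I. (LINT x:T|lborel. f x * e i x) = 0) \<longrightarrow>
          (AE x in lborel. x \<in> T \<longrightarrow> f x = 0))"

definition system_index :: "wavelet_system \<Rightarrow> (int + nat \<times> int) set" where
  "system_index W = scal_ix W <+> (SIGMA l:{base_level W..}. wav_ix W l)"

definition system_fun :: "wavelet_system \<Rightarrow> int + nat \<times> int \<Rightarrow> real \<Rightarrow> real" where
  "system_fun W = case_sum (scal W) (\<lambda>(l, k). wav W l k)"

definition daubechies_basis_line :: "nat \<Rightarrow> wavelet_system \<Rightarrow> bool" where
  "daubechies_basis_line S W \<longleftrightarrow>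
     (\<exists>N u w. daubechies_pair S N u w \<and>
        scal_ix W = UNIV \<and> base_level W = 0 \<and> (\<forall>l. wav_ix W l = UNIV) \<and>
        (\<forall>k x. scal W k x = u (x - of_int k)) \<and>
        (\<forall>l k x. wav W l k x = 2 powr (real l / 2) * w (2 ^ l * x - of_int k))) \<and>
     orthonormal_basis_on UNIV (system_index W) (system_fun W)"

text \<open>
  The \<open>k\<close>-th function (\<open>1 \<le> k \<le> 2 ^ l\<close>) at level \<open>l\<close> of a boundary-corrected family on \<open>[0, 1]\<close>:
  \<open>N\<close> edge functions at either end, dilated from functions \<open>gL\<close>, \<open>gR\<close> on the half line, and
  dilated translates of \<open>g\<close> by \<open>N, \<dots>, 2 ^ l - N - 1\<close> in the interior.
\<close>

definition interval_fun ::
  "nat \<Rightarrow> (real \<Rightarrow> real) \<Rightarrow> (int \<Rightarrow> real \<Rightarrow> real) \<Rightarrow> (int \<Rightarrow> real \<Rightarrow> real) \<Rightarrow> nat \<Rightarrow> int \<Rightarrow> real \<Rightarrow> real"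
where
  "interval_fun N g gL gR l k x = 2 powr (real l / 2) *
     (if k \<le> int N then gL (k - 1) (2 ^ l * x)
      else if k \<le> 2 ^ l - int N then g (2 ^ l * x - of_int (k - 1))
      else gR (2 ^ l - k) (2 ^ l * (1 - x)))"

definition edge_funs :: "nat \<Rightarrow> nat \<Rightarrow> (int \<Rightarrow> real \<Rightarrow> real) \<Rightarrow> bool" where
  "edge_funs S N g \<longleftrightarrow>
     (\<forall>k\<in>{0..<int N}. times_cont_diff_on S {0..} (g k) \<and> (\<forall>x > 2 * real N - 1. g k x = 0))"

text \<open>
  Boundary-corrected Daubechies bases of \<open>L\<^sup>2([0, 1])\<close> after Cohen, Daubechies and Vial: a
  multiresolution analysis whose level \<open>l\<close> space has dimension \<open>2 ^ l\<close>, consists of the interior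
  Daubechies scaling functions plus \<open>N\<close> edge functions at either end, and contains all polynomials
  of degree less than \<open>N\<close>. These conditions determine the spaces spanned by the edge functions;
  the orthonormalisation within them is not prescribed.
\<close>

definition daubechies_basis_interval :: "nat \<Rightarrow> wavelet_system \<Rightarrow> bool" where
  "daubechies_basis_interval S W \<longleftrightarrow>
     (\<exists>N u w uL uR wL wR.
        daubechies_pair S N u w \<and>
        edge_funs S N uL \<and> edge_funs S N uR \<and> edge_funs S N wL \<and> edge_funs S N wR \<and>
        2 * N \<le> 2 ^ base_level W \<and>
        scal_ix W = {1..2 ^ base_level W} \<and> (\<forall>l. wav_ix W l = {1..2 ^ l}) \<and>
        (\<forall>k x. scal W k x = interval_fun N u uL uR (base_level W) k x) \<and>
        (\<forall>l k x. wav W l k x = interval_fun N w wL wR l k x) \<and>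
        (\<forall>l\<ge>base_level W.
           orthonormal_on {0..1} {1..2 ^ l} (interval_fun N u uL uR l) \<and>
           (\<forall>g\<in>interval_fun N u uL uR l ` {1..2 ^ l} \<union> interval_fun N w wL wR l ` {1..2 ^ l}.
              \<exists>a. \<forall>x\<in>{0..1}. g x =
                (\<Sum>m\<in>{1..2 ^ Suc l}. a m * interval_fun N u uL uR (Suc l) m x))) \<and>
        (\<forall>p<N. \<exists>a. \<forall>x\<in>{0..1}. x ^ p = (\<Sum>k\<in>scal_ix W. a k * scal W k x))) \<and>
     orthonormal_basis_on {0..1} (system_index W) (system_fun W)"

definition daubechies_basis :: "nat \<Rightarrow> real set \<Rightarrow> wavelet_system \<Rightarrow> bool" where
  "daubechies_basis S T W \<longleftrightarrow>
     T = UNIV \<and> daubechies_basis_line S W \<or> T = {0..1} \<and> daubechies_basis_interval S W"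


section \<open>Function classes\<close>

text \<open>
  Densities on \<open>T\<close> are total functions on the reals whose values off \<open>T\<close> are never used. Norms take
  values in \<^typ>\<open>ennreal\<close>, so that an infimum over an empty class is infinite.
\<close>

definition sup_norm_on :: "real set \<Rightarrow> (real \<Rightarrow> real) \<Rightarrow> ennreal" where
  "sup_norm_on T h = (SUP x\<in>T. ennreal \<bar>h x\<bar>)"

definition holder_norm :: "wavelet_system \<Rightarrow> real set \<Rightarrow> real \<Rightarrow> (real \<Rightarrow> real) \<Rightarrow> ennreal" where
  "holder_norm W T s f = max
     (SUP k\<in>scal_ix W. ennreal \<bar>LINT x:T|lborel. f x * scal W k x\<bar>)
     (SUP l\<in>{base_level W..}. SUP k\<in>wav_ix W l.
        ennreal (2 powr (real l * (s + 1 / 2)) * \<bar>LINT x:T|lborel. f x * wav W l k x\<bar>))"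

definition holder_ball :: "wavelet_system \<Rightarrow> real set \<Rightarrow> real \<Rightarrow> real \<Rightarrow> (real \<Rightarrow> real) set" where
  "holder_ball W T B s = {f.
     (\<forall>x\<in>T. 0 \<le> f x) \<and> bounded (f ` T) \<and> continuous_on T f \<and>
     set_integrable lborel T f \<and> (LINT x:T|lborel. f x) = 1 \<and>
     holder_norm W T s f \<le> ennreal B}"

definition rate :: "nat \<Rightarrow> real \<Rightarrow> real" where
  "rate n s = (ln (real n) / real n) powr (s / (2 * s + 1))"

definition is_grid :: "real \<Rightarrow> real \<Rightarrow> real \<Rightarrow> nat \<Rightarrow> real set \<Rightarrow> bool" where
  "is_grid \<zeta> r R n G \<longleftrightarrow> G \<subseteq> {r..R} \<and>
     (\<exists>m\<ge>1. \<exists>\<sigma> :: nat \<Rightarrow> real. G = \<sigma> ` {1..m} \<and> \<sigma> 1 = r \<and> \<sigma> m = R \<and>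
        (\<forall>i\<in>{1..<m}. \<sigma> i < \<sigma> (i + 1) \<and>
           \<zeta> / ln (real n) \<le> \<sigma> (i + 1) - \<sigma> i \<and> \<sigma> (i + 1) - \<sigma> i \<le> 2 * \<zeta> / ln (real n)))"

definition separated_class ::
  "wavelet_system \<Rightarrow> real set \<Rightarrow> real \<Rightarrow> real \<Rightarrow> real set \<Rightarrow> real \<Rightarrow> nat \<Rightarrow> real \<Rightarrow> (real \<Rightarrow> real) set"
where
  "separated_class W T B R G L0 n s =
     (if s = R then holder_ball W T B R
      else {f \<in> holder_ball W T B s. \<forall>t\<in>G. s < t \<longrightarrow>
              (INF g\<in>holder_ball W T B t. sup_norm_on T (\<lambda>x. g x - f x)) \<ge> ennreal (L0 * rate n s)})"

definition separated_union ::
  "wavelet_system \<Rightarrow> real set \<Rightarrow> real \<Rightarrow> real \<Rightarrow> real set \<Rightarrow> real \<Rightarrow> nat \<Rightarrow> (real \<Rightarrow> real) set"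
where
  "separated_union W T B R G L0 n = (\<Union>s\<in>G. separated_class W T B R G L0 n s)"


section \<open>Sampling and confidence bands\<close>

definition sample_space :: "real set \<Rightarrow> nat \<Rightarrow> (nat \<Rightarrow> real) measure" where
  "sample_space T n = (\<Pi>\<^sub>M i\<in>{1..n}. restrict_space borel T)"

definition sample_law :: "real set \<Rightarrow> (real \<Rightarrow> real) \<Rightarrow> nat \<Rightarrow> (nat \<Rightarrow> real) measure" where
  "sample_law T f n =
     (\<Pi>\<^sub>M i\<in>{1..n}. density (restrict_space lborel T) (\<lambda>x. ennreal (f x)))"

definition cover_event ::
  "real set \<Rightarrow> nat \<Rightarrow> ((nat \<Rightarrow> real) \<Rightarrow> real \<Rightarrow> real) \<Rightarrow> ((nat \<Rightarrow> real) \<Rightarrow> real \<Rightarrow> real) \<Rightarrow>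
     (real \<Rightarrow> real) \<Rightarrow> (nat \<Rightarrow> real) set"
where
  "cover_event T n c c' f = {X \<in> space (sample_space T n). \<forall>y\<in>T. f y \<in> {c X y..c' X y}}"

definition band_diameter ::
  "real set \<Rightarrow> ((nat \<Rightarrow> real) \<Rightarrow> real \<Rightarrow> real) \<Rightarrow> ((nat \<Rightarrow> real) \<Rightarrow> real \<Rightarrow> real) \<Rightarrow>
     (nat \<Rightarrow> real) \<Rightarrow> ennreal"
where
  "band_diameter T c c' X = sup_norm_on T (\<lambda>y. c' X y - c X y)"

text \<open>
  The last two conditions involve uncountably many \<open>y\<close> and make the coverage probability and the
  expected diameter meaningful.
\<close>

definition random_band ::
  "real set \<Rightarrow> nat \<Rightarrow> ((nat \<Rightarrow> real) \<Rightarrow> real \<Rightarrow> real) \<Rightarrow> ((nat \<Rightarrow> real) \<Rightarrow> real \<Rightarrow> real) \<Rightarrow> bool"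
where
  "random_band T n c c' \<longleftrightarrow>
     (\<forall>y\<in>T. (\<lambda>X. c X y) \<in> borel_measurable (sample_space T n) \<and>
            (\<lambda>X. c' X y) \<in> borel_measurable (sample_space T n) \<and>
            (\<forall>X\<in>space (sample_space T n). c X y \<le> c' X y)) \<and>
     (\<forall>f. continuous_on T f \<longrightarrow> cover_event T n c c' f \<in> sets (sample_space T n)) \<and>
     band_diameter T c c' \<in> borel_measurable (sample_space T n)"

end

theory Submission
  imports Defs
begin

text \<open>
  With probability at least \<open>1 - 1/n\<close> all empirical coefficients at levels \<open>l\<close> with
  \<open>2\<^sup>l \<le> n / ln n\<close> are within a multiple of \<open>\<surd>(ln n / n)\<close> of the true ones. On this event call
  \<open>t\<close> in the grid feasible if some density in \<open>\<Sigma>(t)\<close> is compatible with the empirical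
  coefficients. If \<open>f \<in> \<Sigma>(s)\<close>, then \<open>s\<close> is feasible, and any compatible \<open>g \<in> \<Sigma>(t)\<close> with
  \<open>t \<ge> s\<close> is within a multiple of \<open>r\<^sub>n(s)\<close> of \<open>f\<close> in supremum norm: coarse levels are compared through
  the data, fine levels through the decay of the coefficients. Separation therefore excludes
  feasibility of every \<open>t > s\<close>, so the largest feasible grid point is \<open>s\<close> itself, and a band of radius
  proportional to \<open>r\<^sub>n(s)\<close> about any compatible density in \<open>\<Sigma>(s)\<close> covers \<open>f\<close>.
\<close>

section \<open>Deviations of empirical coefficients\<close>

text \<open>Two obstacles shape the proof. On the line every level carries infinitely many wavelets,
  so a union bound cannot count indices. Each deviation probability is instead bounded by a multiple
  of the second moment of its basis function, and localisation makes these moments sum to a multiple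
  of n / ln n over all coarse levels. Secondly, the largest feasible grid point and the chosen
  density are not evidently measurable in the sample; they are computed from a sample rounded to a
  fine lattice, at the price of doubling the tolerance in feasibility.

  The failure probability 1/n serves every \<alpha> at once, so the band does not involve \<alpha>.
  All constants are built from the overlap bound \<open>M\<close> of the basis, from
  \<open>B\<close> and from \<open>r\<close>; the last enters through
  \<open>1 / (1 - 2 powr (- r))\<close>, which bounds the geometric tails uniformly in s \<ge> r.

  Supremum bounds are not read off a uniformly convergent wavelet series. They come from
  completeness in L2 followed by continuity, which treats the line and the interval by the same
  argument.\<close>

lemma exp_le_quadratic:
  fixes x :: real
  assumes "\<bar>x\<bar> \<le> 1"
  shows "exp x \<le> 1 + x + x\<^sup>2"
proof (cases "0 \<le> x")
  case True
  then show ?thesis using exp_bound[of x] assms by simp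
next
  case False
  \<comment> \<open>For \<open>x = - y\<close> the claim reads
    \<open>1 \<le> exp y * (1 - y + y^2)\<close>, so a lower Taylor bound for \<open>exp y\<close>
    is enough.\<close>
  define y where "y = - x"
  have y: "0 \<le> y" "y \<le> 1" using False assms by (auto simp: y_def)
  have q: "1 + y + y\<^sup>2 / 2 \<le> exp y" using exp_lower_Taylor_quadratic[of y] y by simp
  have pos: "0 < 1 + y + y\<^sup>2 / 2" using y by (simp add: add_pos_nonneg)
  have nn: "0 \<le> 1 - y + y\<^sup>2" using y by (intro add_nonneg_nonneg) auto
  have "1 \<le> (1 + y + y\<^sup>2 / 2) * (1 - y + y\<^sup>2)"
  proof -
    have "(1 + y + y\<^sup>2 / 2) * (1 - y + y\<^sup>2) = 1 + (y^2 + y^3 + y^4) / 2"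
      by (simp add: field_simps power2_eq_square power3_eq_cube power4_eq_xxxx)
    then show ?thesis using y by simp
  qed
  also have "\<dots> \<le> exp y * (1 - y + y\<^sup>2)" using q nn by (intro mult_right_mono) auto
  finally have "exp (- y) \<le> 1 - y + y\<^sup>2" by (simp add: exp_minus field_simps)
  then show ?thesis by (simp add: y_def)
qed

text \<open>A Bernstein-type bound: \<open>Y\<close> differs from its mean by at most
  \<open>2 * K\<close>, so the condition on \<theta> keeps the exponent in [-1, 1], where the
  quadratic bound holds pointwise, and the linear term integrates to zero. Keeping the second moment
  instead of the square of \<open>K\<close> is what later makes the bounds summable.\<close>

lemma (in prob_space) expectation_exp_centred_le:
  fixes Y :: "'a \<Rightarrow> real"
  assumes Y[measurable]: "Y \<in> borel_measurable M" and bound: "\<And>x. x \<in> space M \<Longrightarrow> \<bar>Y x\<bar> \<le> K"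
    and \<theta>: "2 * \<bar>\<theta>\<bar> * K \<le> 1"
  shows "expectation (\<lambda>x. exp (\<theta> * (Y x - expectation Y))) \<le> exp (\<theta>\<^sup>2 * expectation (\<lambda>x. (Y x)\<^sup>2))"
proof -
  obtain x0 where "x0 \<in> space M" using not_empty by auto
  then have K: "0 \<le> K" using bound[of x0] by linarith
  define m where "m = expectation Y"
  have iY: "integrable M Y"
    by (rule integrable_const_bound[of _ K]) (use bound in auto)
  have iY2: "integrable M (\<lambda>x. (Y x)\<^sup>2)"
    by (rule integrable_const_bound[of _ "K\<^sup>2"]) (use bound power_mono[of "\<bar>Y _\<bar>" K 2] in auto)
  have mK: "\<bar>m\<bar> \<le> K"
  proof -
    have "\<bar>m\<bar> \<le> expectation (\<lambda>x. \<bar>Y x\<bar>)" unfolding m_def by (rule integral_abs_bound)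
    also have "\<dots> \<le> expectation (\<lambda>_. K)" using iY bound by (intro integral_mono) auto
    finally show ?thesis by (simp add: prob_space)
  qed
  have small: "\<bar>\<theta> * (Y x - m)\<bar> \<le> 1" if "x \<in> space M" for x
  proof -
    have "\<bar>\<theta> * (Y x - m)\<bar> \<le> \<bar>\<theta>\<bar> * (2 * K)"
      unfolding abs_mult using bound[OF that] mK by (intro mult_left_mono) auto
    then show ?thesis using \<theta> by simp
  qed
  have "expectation (\<lambda>x. exp (\<theta> * (Y x - m))) \<le> expectation (\<lambda>x. 1 + \<theta> * (Y x - m) + \<theta>\<^sup>2 * ((Y x)\<^sup>2 - 2 * m * Y x + m\<^sup>2))"
  proof (rule integral_mono)
    show "integrable M (\<lambda>x. exp (\<theta> * (Y x - m)))"
    proof (rule integrable_const_bound[of _ "exp 1"])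
      show "AE x in M. norm (exp (\<theta> * (Y x - m))) \<le> exp 1"
        using small by (intro AE_I2) (simp add: abs_le_iff)
    qed simp
    show "integrable M (\<lambda>x. 1 + \<theta> * (Y x - m) + \<theta>\<^sup>2 * ((Y x)\<^sup>2 - 2 * m * Y x + m\<^sup>2))"
      using iY iY2 by auto
    show "exp (\<theta> * (Y x - m)) \<le> 1 + \<theta> * (Y x - m) + \<theta>\<^sup>2 * ((Y x)\<^sup>2 - 2 * m * Y x + m\<^sup>2)"
      if "x \<in> space M" for x
      using exp_le_quadratic[OF small[OF that]]
      by (simp add: power_mult_distrib) (simp add: power2_eq_square algebra_simps)
  qed
  also have "\<dots> = 1 + \<theta>\<^sup>2 * (expectation (\<lambda>x. (Y x)\<^sup>2) - m\<^sup>2)"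
    using iY iY2 by (simp add: prob_space m_def[symmetric] power2_eq_square algebra_simps)
  also have "\<dots> \<le> 1 + \<theta>\<^sup>2 * expectation (\<lambda>x. (Y x)\<^sup>2)" by (simp add: mult_left_mono)
  also have "\<dots> \<le> exp (\<theta>\<^sup>2 * expectation (\<lambda>x. (Y x)\<^sup>2))" by (rule exp_ge_add_one_self)
  finally show ?thesis by (simp add: m_def)
qed

text \<open>Subtracting \<open>1\<close> from \<open>cosh\<close> makes the bound proportional to the second moment of \<open>Y\<close>, so that
  it can be summed over infinitely many basis functions.\<close>

lemma (in prob_space) iid_sum_deviation:
  fixes Y :: "'a \<Rightarrow> real"
  assumes Y[measurable]: "Y \<in> borel_measurable M" and bound: "\<And>x. x \<in> space M \<Longrightarrow> \<bar>Y x\<bar> \<le> K"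
    and J: "finite J" and \<theta>: "0 \<le> \<theta>" "2 * \<theta> * K \<le> 1" and t: "0 \<le> t"
  defines "v \<equiv> real (card J) * \<theta>\<^sup>2 * expectation (\<lambda>x. (Y x)\<^sup>2)"
  shows "(cosh (\<theta> * t) - 1) *
    measure (\<Pi>\<^sub>M j\<in>J. M) {X \<in> space (\<Pi>\<^sub>M j\<in>J. M). t \<le> \<bar>\<Sum>j\<in>J. Y (X j) - expectation Y\<bar>} \<le> v * exp v"
proof -
  interpret P: product_prob_space "\<lambda>_. M" J by unfold_locales
  let ?P = "\<Pi>\<^sub>M j\<in>J. M"
  have one: "measure ?P (space ?P) = 1"
    by (intro prob_space.prob_space prob_space_PiM prob_space_axioms)
  define m where "m = expectation Y"
  define Z where "Z X = (\<Sum>j\<in>J. Y (X j) - m)" for X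
  have [measurable]: "Z \<in> borel_measurable ?P" unfolding Z_def by measurable
  have iY: "integrable M (\<lambda>x. exp (\<eta> * (Y x - m)))" for \<eta>
  proof (rule integrable_const_bound[of _ "exp (\<bar>\<eta>\<bar> * (K + \<bar>m\<bar>))"])
    show "AE x in M. norm (exp (\<eta> * (Y x - m))) \<le> exp (\<bar>\<eta>\<bar> * (K + \<bar>m\<bar>))"
    proof (rule AE_I2)
      fix x assume "x \<in> space M"
      have "\<eta> * (Y x - m) \<le> \<bar>\<eta>\<bar> * \<bar>Y x - m\<bar>" by (metis abs_ge_self abs_mult)
      also have "\<dots> \<le> \<bar>\<eta>\<bar> * (K + \<bar>m\<bar>)"
        using bound[OF \<open>x \<in> space M\<close>] by (intro mult_left_mono) auto
      finally show "norm (exp (\<eta> * (Y x - m))) \<le> exp (\<bar>\<eta>\<bar> * (K + \<bar>m\<bar>))" by simp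
    qed
  qed simp
  have expZ: "(\<lambda>X. exp (\<eta> * Z X)) = (\<lambda>X. \<Prod>j\<in>J. exp (\<eta> * (Y (X j) - m)))" for \<eta>
    unfolding Z_def by (simp add: sum_distrib_left exp_sum[OF J])
  have iZ: "integrable ?P (\<lambda>X. exp (\<eta> * Z X))" for \<eta>
    unfolding expZ by (rule P.product_integrable_prod[OF J]) (rule iY)
  have EZ: "(\<integral>X. exp (\<eta> * Z X) \<partial>?P) \<le> exp v" if "\<bar>\<eta>\<bar> = \<theta>" for \<eta>
  proof -
    have "(\<integral>X. exp (\<eta> * Z X) \<partial>?P) = (\<Prod>j\<in>J. expectation (\<lambda>x. exp (\<eta> * (Y x - m))))"
      unfolding expZ by (rule P.product_integral_prod[OF J]) (rule iY)
    also have "\<dots> \<le> (\<Prod>j\<in>J. exp (\<eta>\<^sup>2 * expectation (\<lambda>x. (Y x)\<^sup>2)))"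
      using expectation_exp_centred_le[OF Y bound, of \<eta>] that \<theta>
      by (intro prod_mono) (auto simp: m_def)
    also have "\<dots> = exp v"
      using that by (simp add: v_def exp_of_nat_mult[symmetric] mult.assoc power2_eq_square abs_mult_self_eq[of \<eta>, symmetric])
    finally show ?thesis .
  qed
  let ?A = "{X \<in> space ?P. t \<le> \<bar>Z X\<bar>}"
  have A[measurable]: "?A \<in> sets ?P" by measurable
  have iC: "integrable ?P (\<lambda>X. cosh (\<theta> * Z X))"
    using iZ[of \<theta>] iZ[of "-\<theta>"] by (auto simp: cosh_field_def)
  have "(cosh (\<theta> * t) - 1) * measure ?P ?A = (\<integral>X. (cosh (\<theta> * t) - 1) * indicator ?A X \<partial>?P)"
    by simp
  \<comment> \<open>Markov's inequality for the nonnegative variable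
    \<open>cosh (\<theta> * Z) - 1\<close>; evenness of cosh treats both tails at once.\<close>
  also have "\<dots> \<le> (\<integral>X. cosh (\<theta> * Z X) - 1 \<partial>?P)"
  proof (rule integral_mono)
    show "(cosh (\<theta> * t) - 1) * indicator ?A X \<le> cosh (\<theta> * Z X) - 1" for X
    proof (cases "X \<in> ?A")
      case True
      have "\<bar>\<theta> * t\<bar> \<le> \<bar>\<theta> * Z X\<bar>" unfolding abs_mult using True t by (intro mult_left_mono) auto
      then have "cosh \<bar>\<theta> * t\<bar> \<le> cosh \<bar>\<theta> * Z X\<bar>" by (subst cosh_real_nonneg_le_iff) auto
      then show ?thesis using True by simp
    qed (use cosh_real_ge_1 in auto)
    show "integrable ?P (\<lambda>X. (cosh (\<theta> * t) - 1) * indicator ?A X)"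
      using A by (intro integrable_mult_right integrable_real_indicator) (auto simp: P.emeasure_eq_measure)
  qed (use iC in auto)
  also have "\<dots> = ((\<integral>X. exp (\<theta> * Z X) \<partial>?P) + (\<integral>X. exp (- \<theta> * Z X) \<partial>?P)) / 2 - 1"
    using iZ[of \<theta>] iZ[of "-\<theta>"] one by (simp add: cosh_field_def)
  also have "\<dots> \<le> exp v - 1" using EZ[of \<theta>] EZ[of "-\<theta>"] \<theta> by simp
  \<comment> \<open>This is \<open>1 - v \<le> exp (- v)\<close> multiplied by \<open>exp v\<close>;
    it exposes the factor \<open>v\<close> that the summation needs.\<close>
  also have "\<dots> \<le> v * exp v"
    using exp_ge_add_one_self[of "-v"] by (simp add: exp_minus field_simps)
  finally show ?thesis by (simp add: Z_def m_def)
qed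

section \<open>Orthonormal expansions\<close>

lemma integrable_mult_of_squares:
  fixes f g :: "'a \<Rightarrow> real"
  assumes [measurable]: "f \<in> borel_measurable N" "g \<in> borel_measurable N"
    and "integrable N (\<lambda>x. (f x)\<^sup>2)" "integrable N (\<lambda>x. (g x)\<^sup>2)"
  shows "integrable N (\<lambda>x. f x * g x)"
proof (rule Bochner_Integration.integrable_bound)
  show "integrable N (\<lambda>x. (f x)\<^sup>2 + (g x)\<^sup>2)" using assms by auto
  have "\<bar>a * b\<bar> \<le> a\<^sup>2 + b\<^sup>2" for a b :: real
  proof -
    have "\<bar>a * b\<bar> \<le> 2 * \<bar>a\<bar> * \<bar>b\<bar>" by (simp add: abs_mult)
    then show ?thesis using sum_squares_bound[of "\<bar>a\<bar>" "\<bar>b\<bar>"] by simp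
  qed
  then show "AE x in N. norm (f x * g x) \<le> norm ((f x)\<^sup>2 + (g x)\<^sup>2)" by (intro AE_I2) simp
qed simp

text \<open>By completeness \<open>h\<close> agrees almost everywhere with the pointwise limit of its expansion;
  Bessel's inequality and Fatou's lemma keep that limit square integrable.\<close>

lemma AE_bound_of_expansion:
  fixes e :: "'i \<Rightarrow> 'a \<Rightarrow> real" and h :: "'a \<Rightarrow> real"
  assumes I: "countable I"
    and e[measurable]: "\<And>i. i \<in> I \<Longrightarrow> e i \<in> borel_measurable N"
    and e_int: "\<And>i. i \<in> I \<Longrightarrow> integrable N (e i)"
    and orth: "\<And>i j. i \<in> I \<Longrightarrow> j \<in> I \<Longrightarrow> (\<integral>x. e i x * e j x \<partial>N) = (if i = j then 1 else 0)"
    and complete: "\<And>f. f \<in> borel_measurable N \<Longrightarrow> integrable N (\<lambda>x. (f x)\<^sup>2) \<Longrightarrow>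
      (\<And>i. i \<in> I \<Longrightarrow> (\<integral>x. f x * e i x \<partial>N) = 0) \<Longrightarrow> AE x in N. f x = 0"
    and h[measurable]: "h \<in> borel_measurable N" and h2: "integrable N (\<lambda>x. (h x)\<^sup>2)"
    and Q: "\<And>x F. x \<in> space N \<Longrightarrow> finite F \<Longrightarrow> F \<subseteq> I \<Longrightarrow>
      (\<Sum>i\<in>F. \<bar>(\<integral>x. h x * e i x \<partial>N) * e i x\<bar>) \<le> Q"
  shows "AE x in N. \<bar>h x\<bar> \<le> Q"
proof -
  define c where "c i = (\<integral>x. h x * e i x \<partial>N)" for i
  define F where "F n = {i\<in>I. to_nat_on I i < n}" for n
  \<comment> \<open>The inner index set has at most one element. Writing the term as a sum over it
    treats finite and infinite \<open>I\<close> alike.\<close>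
  define a where "a k x = (\<Sum>i\<in>{i\<in>I. to_nat_on I i = k}. c i * e i x)" for k x
  define S where "S n x = (\<Sum>i\<in>F n. c i * e i x)" for n x
  define g where "g x = (\<Sum>k. a k x)" for x
  have injI: "inj_on (to_nat_on I) I" using I by (rule inj_on_to_nat_on)
  have finF: "finite (F n)" for n
    by (rule inj_on_finite[of "to_nat_on I" _ "{..<n}"]) (auto simp: F_def intro: inj_on_subset[OF injI])
  have FI: "F n \<subseteq> I" for n by (auto simp: F_def)
  have FD: "i \<in> I" if "i \<in> F n" for i n using FI that by blast
  have a_meas[measurable]: "a k \<in> borel_measurable N" for k
    unfolding a_def by (intro borel_measurable_sum borel_measurable_times) (auto intro: e)
  have S_meas[measurable]: "S n \<in> borel_measurable N" for n
    unfolding S_def by (intro borel_measurable_sum borel_measurable_times) (auto intro: e subsetD[OF FI])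
  have g_meas[measurable]: "g \<in> borel_measurable N"
    unfolding g_def by measurable
  have group: "(\<Sum>k<n. \<Sum>i\<in>{i\<in>I. to_nat_on I i = k}. u i) = (\<Sum>i\<in>F n. u i)" for n and u :: "'i \<Rightarrow> real"
  proof -
    have "(\<Sum>k<n. \<Sum>i\<in>{i\<in>I. to_nat_on I i = k}. u i) = (\<Sum>k<n. \<Sum>i\<in>{i\<in>F n. to_nat_on I i = k}. u i)"
      by (intro sum.cong) (auto simp: F_def)
    also have "\<dots> = (\<Sum>i\<in>F n. u i)" by (rule sum.group[OF finF]) (auto simp: F_def)
    finally show ?thesis .
  qed
  have S_eq: "S n x = (\<Sum>k<n. a k x)" for n x unfolding S_def a_def group ..
  have Sabs: "\<bar>S n x\<bar> \<le> Q" if "x \<in> space N" for n x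
    using Q[OF that finF FI, of n] sum_abs[of "\<lambda>i. c i * e i x" "F n"] unfolding S_def c_def by linarith
  have summ: "summable (\<lambda>k. a k x)" if x: "x \<in> space N" for x
  proof -
    have "(\<Sum>k<n. \<bar>a k x\<bar>) \<le> Q" for n
    proof -
      have "(\<Sum>k<n. \<bar>a k x\<bar>) \<le> (\<Sum>k<n. \<Sum>i\<in>{i\<in>I. to_nat_on I i = k}. \<bar>c i * e i x\<bar>)"
        unfolding a_def by (intro sum_mono sum_abs)
      also have "\<dots> = (\<Sum>i\<in>F n. \<bar>c i * e i x\<bar>)" by (rule group)
      also have "\<dots> \<le> Q" using Q[OF x finF FI] unfolding c_def .
      finally show ?thesis .
    qed
    then have "summable (\<lambda>k. \<bar>a k x\<bar>)"
      by (intro summableI_nonneg_bounded[of _ Q]) auto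
    then show ?thesis by (rule summable_rabs_cancel)
  qed
  have lim: "(\<lambda>n. S n x) \<longlonglongrightarrow> g x" if "x \<in> space N" for x
    unfolding S_eq g_def using summ[OF that] by (rule summable_LIMSEQ)
  have gabs: "\<bar>g x\<bar> \<le> Q" if "x \<in> space N" for x
    by (rule LIMSEQ_le_const2[OF tendsto_rabs[OF lim[OF that]]]) (use Sabs[OF that] in auto)
  have e2: "integrable N (\<lambda>x. (e i x)\<^sup>2)" if "i \<in> I" for i
  proof -
    \<comment> \<open>The Bochner integral of a non-integrable function is 0, so having norm 1
      already implies square integrability.\<close>
    have "(\<integral>x. (e i x)\<^sup>2 \<partial>N) \<noteq> 0" using orth[OF that that] by (simp add: power2_eq_square)
    then show ?thesis using not_integrable_integral_eq by blast
  qed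
  have ee: "integrable N (\<lambda>x. e i x * e j x)" if "i \<in> I" "j \<in> I" for i j
    using that by (intro integrable_mult_of_squares e e2)
  have he: "integrable N (\<lambda>x. h x * e i x)" if "i \<in> I" for i
    using that by (intro integrable_mult_of_squares e e2 h h2)
  have Se: "(\<integral>x. S n x * e j x \<partial>N) = (if j \<in> F n then c j else 0)" if j: "j \<in> I" for n j
  proof -
    have "(\<integral>x. S n x * e j x \<partial>N) = (\<integral>x. (\<Sum>i\<in>F n. c i * (e i x * e j x)) \<partial>N)"
      by (simp add: S_def sum_distrib_right mult.assoc)
    also have "\<dots> = (\<Sum>i\<in>F n. c i * (\<integral>x. e i x * e j x \<partial>N))"
      using ee[OF _ j] FI by (subst Bochner_Integration.integral_sum) auto
    also have "\<dots> = (\<Sum>i\<in>F n. if i = j then c j else 0)"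
      by (intro sum.cong refl) (simp add: orth[OF FD j])
    also have "\<dots> = (if j \<in> F n then c j else 0)" using finF by (simp add: sum.delta)
    finally show ?thesis .
  qed
  have S2i: "integrable N (\<lambda>x. S n x * e j x)" if "j \<in> I" for n j
    unfolding S_def sum_distrib_right mult.assoc
    using ee[OF _ that] FI by (intro Bochner_Integration.integrable_sum integrable_mult_right) auto
  have SSi: "integrable N (\<lambda>x. S n x * S n x)" for n
  proof -
    have "integrable N (\<lambda>x. \<Sum>i\<in>F n. c i * (S n x * e i x))"
      using S2i FI by (intro Bochner_Integration.integrable_sum integrable_mult_right) auto
    then show ?thesis unfolding S_def[of n] by (simp add: sum_distrib_left mult_ac)
  qed
  have hSi: "integrable N (\<lambda>x. h x * S n x)" for n
    by (intro integrable_mult_of_squares h S_meas h2) (use SSi in \<open>simp add: power2_eq_square\<close>)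
  have hS: "(\<integral>x. h x * S n x \<partial>N) = (\<Sum>i\<in>F n. (c i)\<^sup>2)" for n
  proof -
    have "(\<integral>x. h x * S n x \<partial>N) = (\<integral>x. (\<Sum>i\<in>F n. c i * (h x * e i x)) \<partial>N)"
      by (simp add: S_def sum_distrib_left mult_ac)
    also have "\<dots> = (\<Sum>i\<in>F n. (c i)\<^sup>2)"
      using he FI by (subst Bochner_Integration.integral_sum) (auto simp: c_def power2_eq_square)
    finally show ?thesis .
  qed
  have SS: "(\<integral>x. S n x * S n x \<partial>N) = (\<Sum>i\<in>F n. (c i)\<^sup>2)" for n
  proof -
    have "(\<integral>x. S n x * S n x \<partial>N) = (\<integral>x. (\<Sum>i\<in>F n. c i * (S n x * e i x)) \<partial>N)"
    proof (rule Bochner_Integration.integral_cong)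
      fix x show "S n x * S n x = (\<Sum>i\<in>F n. c i * (S n x * e i x))"
        by (subst (2) S_def) (simp add: sum_distrib_left mult_ac)
    qed simp
    also have "\<dots> = (\<Sum>i\<in>F n. c i * (\<integral>x. S n x * e i x \<partial>N))"
      using S2i FI by (subst Bochner_Integration.integral_sum) auto
    also have "\<dots> = (\<Sum>i\<in>F n. (c i)\<^sup>2)"
      by (intro sum.cong refl) (simp add: Se[OF FD] power2_eq_square)
    finally show ?thesis .
  qed
  have bessel: "(\<integral>\<^sup>+x. ennreal ((h x - S n x)\<^sup>2) \<partial>N) \<le> ennreal (\<integral>x. (h x)\<^sup>2 \<partial>N)" for n
  proof -
    have eq: "(\<lambda>x. (h x - S n x)\<^sup>2) = (\<lambda>x. (h x)\<^sup>2 - 2 * (h x * S n x) + S n x * S n x)"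
      by (simp add: power2_eq_square algebra_simps)
    have int: "integrable N (\<lambda>x. (h x - S n x)\<^sup>2)"
      unfolding eq using h2 hSi SSi by auto
    have "(\<integral>x. (h x - S n x)\<^sup>2 \<partial>N) = (\<integral>x. (h x)\<^sup>2 \<partial>N) - (\<Sum>i\<in>F n. (c i)\<^sup>2)"
      unfolding eq using h2 hSi[of n] SSi[of n] hS[of n] SS[of n] by simp
    also have "\<dots> \<le> (\<integral>x. (h x)\<^sup>2 \<partial>N)" by (simp add: sum_nonneg)
    finally show ?thesis using int by (subst nn_integral_eq_integral) (auto intro: ennreal_leI)
  qed
  have hg2: "integrable N (\<lambda>x. (h x - g x)\<^sup>2)"
  proof (rule integrableI_bounded)
    have "(\<integral>\<^sup>+x. ennreal (norm ((h x - g x)\<^sup>2)) \<partial>N)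
        = (\<integral>\<^sup>+x. liminf (\<lambda>n. ennreal ((h x - S n x)\<^sup>2)) \<partial>N)"
    proof (rule nn_integral_cong)
      fix x assume "x \<in> space N"
      then have "(\<lambda>n. ennreal ((h x - S n x)\<^sup>2)) \<longlonglongrightarrow> ennreal ((h x - g x)\<^sup>2)"
        by (intro tendsto_ennrealI tendsto_intros lim)
      then show "ennreal (norm ((h x - g x)\<^sup>2)) = liminf (\<lambda>n. ennreal ((h x - S n x)\<^sup>2))"
        using lim_imp_Liminf[OF sequentially_bot] by fastforce
    qed
    also have "\<dots> \<le> liminf (\<lambda>n. \<integral>\<^sup>+x. ennreal ((h x - S n x)\<^sup>2) \<partial>N)"
      by (rule nn_integral_liminf) measurable
    also have "\<dots> \<le> ennreal (\<integral>x. (h x)\<^sup>2 \<partial>N)"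
      using bessel by (intro Liminf_le always_eventually) auto
    finally show "(\<integral>\<^sup>+x. ennreal (norm ((h x - g x)\<^sup>2)) \<partial>N) < \<infinity>"
      by (simp add: le_less_trans ennreal_less_top)
  qed measurable
  have "(\<integral>x. (h x - g x) * e j x \<partial>N) = 0" if j: "j \<in> I" for j
  proof -
    have gi: "integrable N (\<lambda>x. g x * e j x)" and "(\<lambda>n. \<integral>x. S n x * e j x \<partial>N) \<longlonglongrightarrow> (\<integral>x. g x * e j x \<partial>N)"
    proof -
      \<comment> \<open>The partial sums are bounded by \<open>Q\<close>, so integrability of
        \<open>e j\<close> itself supplies the dominating function; the limit \<open>g\<close>
        therefore inherits the coefficients of \<open>h\<close>.\<close>
      have d: "integrable N (\<lambda>x. Q * \<bar>e j x\<bar>)" using e_int[OF j] by auto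
      have m1: "(\<lambda>x. g x * e j x) \<in> borel_measurable N" "\<And>n. (\<lambda>x. S n x * e j x) \<in> borel_measurable N"
        using e[OF j] by measurable
      have m2: "AE x in N. (\<lambda>n. S n x * e j x) \<longlonglongrightarrow> g x * e j x"
        by (intro AE_I2 tendsto_intros lim)
      have m3: "AE x in N. norm (S n x * e j x) \<le> Q * \<bar>e j x\<bar>" for n
        by (intro AE_I2) (auto simp: abs_mult intro!: mult_right_mono Sabs)
      show "integrable N (\<lambda>x. g x * e j x)" by (rule integrable_dominated_convergence[OF m1 d m2 m3])
      show "(\<lambda>n. \<integral>x. S n x * e j x \<partial>N) \<longlonglongrightarrow> (\<integral>x. g x * e j x \<partial>N)"
        by (rule integral_dominated_convergence[OF m1 d m2 m3])
    qed
    moreover have "(\<lambda>n. \<integral>x. S n x * e j x \<partial>N) \<longlonglongrightarrow> c j"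
    proof (rule tendsto_eventually)
      show "\<forall>\<^sub>F n in sequentially. (\<integral>x. S n x * e j x \<partial>N) = c j"
        using eventually_gt_at_top[of "to_nat_on I j"] by eventually_elim (simp add: Se j F_def)
    qed
    ultimately have "(\<integral>x. g x * e j x \<partial>N) = c j" using LIMSEQ_unique by blast
    then show ?thesis using he[OF j] gi by (simp add: left_diff_distrib c_def)
  qed
  then have "AE x in N. h x - g x = 0" using hg2 by (intro complete) auto
  then show ?thesis
  proof (rule AE_mp, intro AE_I2 impI)
    fix x assume "x \<in> space N" "h x - g x = 0"
    then show "\<bar>h x\<bar> \<le> Q" using gabs[of x] by simp
  qed
qed

section \<open>Geometric sums over dyadic levels below and above a threshold\<close>

lemma sum_geometric_below_threshold:
  fixes p :: real
  assumes "finite A" and "\<And>l. l \<in> A \<Longrightarrow> 2 ^ l \<le> p" and "0 \<le> p"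
  shows "(\<Sum>l\<in>A. sqrt 2 ^ l) \<le> 4 * sqrt p"
proof (cases "A = {}")
  case False
  define j where "j = Max A"
  have j: "j \<in> A" and "A \<subseteq> {..j}" using assms False by (auto simp: j_def)
  then have "(\<Sum>l\<in>A. sqrt 2 ^ l) \<le> (\<Sum>l\<le>j. sqrt 2 ^ l)" by (intro sum_mono2) auto
  also have "(\<Sum>l\<le>j. sqrt 2 ^ l) \<le> 4 * sqrt 2 ^ j"
  proof (induction j)
    case (Suc j)
    \<comment> \<open>The induction step needs \<open>4 + sqrt 2 \<le> 4 * sqrt 2\<close>. The
      optimal factor would be 2 + sqrt 2, and 4 is a convenient larger one.\<close>
    have "4 \<le> 3 * sqrt 2" by (rule power2_le_imp_le) (auto simp: power_mult_distrib)
    then have "4 * sqrt 2 ^ j \<le> 3 * sqrt 2 * sqrt 2 ^ j" by (intro mult_right_mono) auto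
    moreover have "(\<Sum>l\<le>Suc j. sqrt 2 ^ l) = (\<Sum>l\<le>j. sqrt 2 ^ l) + sqrt 2 * sqrt 2 ^ j" by simp
    ultimately show ?case using Suc unfolding power_Suc mult.assoc by linarith
  qed auto
  also have "4 * sqrt 2 ^ j \<le> 4 * sqrt p"
    using assms(2)[OF j] by (simp flip: real_sqrt_power)
  finally show ?thesis .
qed (use assms in auto)

lemma sum_power2_below_threshold:
  fixes p :: real
  assumes "finite A" and "\<And>l. l \<in> A \<Longrightarrow> 2 ^ l \<le> p" and "0 \<le> p"
  shows "(\<Sum>l\<in>A. 2 ^ l) \<le> 2 * p"
proof (cases "A = {}")
  case False
  define j where "j = Max A"
  have j: "j \<in> A" and "A \<subseteq> {..j}" using assms False by (auto simp: j_def)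
  then have "(\<Sum>l\<in>A. 2 ^ l) \<le> (\<Sum>l\<le>j. (2::real) ^ l)" by (intro sum_mono2) auto
  also have "(\<Sum>l\<le>j. (2::real) ^ l) \<le> 2 * 2 ^ j" by (induction j) auto
  also have "2 * 2 ^ j \<le> 2 * p" using assms(2)[OF j] by simp
  finally show ?thesis .
qed (use assms in auto)

text \<open>The smallest level dominates. The ratio is at most \<open>2 powr (- r)\<close> for every
  \<open>s \<ge> r\<close>, so the denominator can be kept free of \<open>s\<close>; this gives
  constants uniform over the grid.\<close>

lemma sum_geometric_above_threshold:
  fixes p r s :: real
  assumes "finite A" and "\<And>l. l \<in> A \<Longrightarrow> p \<le> 2 ^ l" and "0 < p" and r: "0 < r" "r \<le> s"
  shows "(\<Sum>l\<in>A. (2 powr (- s)) ^ l) \<le> p powr (- s) / (1 - 2 powr (- r))"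
proof -
  have q: "0 < 2 powr (- r)" "2 powr (- r) < (1::real)" "2 powr (- s) \<le> 2 powr (- r)"
    using r by (auto simp: powr_less_one)
  show ?thesis
  proof (cases "A = {}")
    case False
    define x :: real where "x = 2 powr (- s)"
    have xr: "x \<le> 2 powr (- r)" using q(3) by (simp only: x_def)
    have x: "0 < x" "x < 1" using le_less_trans[OF xr q(2)] by (simp_all add: x_def)
    define j where "j = Min A"
    have j: "j \<in> A" and jl: "l \<in> A \<Longrightarrow> j \<le> l" for l using assms False by (auto simp: j_def)
    have "(\<Sum>l\<in>A. x ^ l) = x ^ j * (\<Sum>l\<in>A. x ^ (l - j))"
      unfolding sum_distrib_left by (intro sum.cong) (auto simp flip: power_add dest: jl)
    also have "(\<Sum>l\<in>A. x ^ (l - j)) = (\<Sum>l\<in>(\<lambda>l. l - j) ` A. x ^ l)"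
      by (subst sum.reindex) (auto intro!: inj_onI dest!: jl)
    also have "\<dots> \<le> (\<Sum>l. x ^ l)"
      using x assms(1) by (intro sum_le_suminf summable_geometric) auto
    also have "(\<Sum>l. x ^ l) = 1 / (1 - x)" using x by (intro suminf_geometric) auto
    also have "1 / (1 - x) \<le> 1 / (1 - 2 powr (- r))" using x xr q by (intro divide_left_mono) auto
    also have "x ^ j = (2 ^ j) powr (- s)"
      unfolding x_def by (simp add: powr_powr powr_realpow[symmetric] mult.commute)
    also have "\<dots> \<le> p powr (- s)" using assms(2)[OF j] r \<open>0 < p\<close> by (intro powr_mono2') auto
    finally show ?thesis using q x by (simp add: x_def mult_left_mono divide_right_mono mult_right_mono)
  qed (use q in auto)
qed

text \<open>Continuity from below along an enumeration. It carries a bound that is uniform over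
  finite families to the infinitely many translates on a level.\<close>

lemma (in finite_measure) measure_countable_UN_le:
  assumes K: "countable K" and A: "\<And>i. i \<in> K \<Longrightarrow> A i \<in> sets M"
    and le: "\<And>F. finite F \<Longrightarrow> F \<subseteq> K \<Longrightarrow> measure M (\<Union>i\<in>F. A i) \<le> C"
  shows "measure M (\<Union>i\<in>K. A i) \<le> C"
proof -
  define F where "F n = {i\<in>K. to_nat_on K i < n}" for n
  have fin: "finite (F n)" for n
    by (rule inj_on_finite[of "to_nat_on K" _ "{..<n}"])
      (auto simp: F_def intro: inj_on_subset[OF inj_on_to_nat_on[OF K]])
  have sub: "F n \<subseteq> K" for n by (auto simp: F_def)
  have "(\<lambda>n. measure M (\<Union>i\<in>F n. A i)) \<longlonglongrightarrow> measure M (\<Union>n. \<Union>i\<in>F n. A i)"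
  proof (rule finite_Lim_measure_incseq)
    show "range (\<lambda>n. \<Union>i\<in>F n. A i) \<subseteq> sets M"
      using A fin sub by (intro image_subsetI sets.finite_UN) (auto dest: subsetD)
    show "incseq (\<lambda>n. \<Union>i\<in>F n. A i)" by (auto simp: incseq_def F_def intro: less_le_trans)
  qed
  moreover have "(\<Union>n. \<Union>i\<in>F n. A i) = (\<Union>i\<in>K. A i)" by (auto simp: F_def)
  ultimately show ?thesis using le[OF fin sub] by (auto intro: LIMSEQ_le_const2)
qed

text \<open>What the statistical argument needs to know about a wavelet basis, on the line and on
  the interval alike. \<open>level_sum\<close> encodes localisation: the functions of one level
  overlap boundedly at every point, and it speaks of finite \<open>F\<close> because a level may be
  infinite. \<open>integrable_e\<close> supplies dominating functions for the expansion.
  \<open>equicontinuous\<close>, uniform over a whole level, is what permits rounding the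
  data.\<close>

locale localized_basis =
  fixes T :: "real set" and I :: "'i set" and e :: "'i \<Rightarrow> real \<Rightarrow> real"
    and lev :: "'i \<Rightarrow> nat" and M :: real
  assumes T_cases: "T = UNIV \<or> T = {0..1}"
    and basis: "orthonormal_basis_on T I e"
    and countable_I: "countable I"
    and integrable_e: "\<And>i. i \<in> I \<Longrightarrow> set_integrable lborel T (e i)"
    and M_ge_1: "1 \<le> M"
    and level_sum: "\<And>x l F. x \<in> T \<Longrightarrow> finite F \<Longrightarrow> F \<subseteq> {i \<in> I. lev i = l} \<Longrightarrow>
      (\<Sum>i\<in>F. \<bar>e i x\<bar>) \<le> M * sqrt 2 ^ l"
    and equicontinuous: "\<And>l \<delta>. 0 < \<delta> \<Longrightarrow> \<exists>d>0. \<forall>i\<in>I. lev i = l \<longrightarrow>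
      (\<forall>x\<in>T. \<forall>y\<in>T. \<bar>x - y\<bar> < d \<longrightarrow> \<bar>e i x - e i y\<bar> \<le> \<delta>)"
begin

definition coef :: "(real \<Rightarrow> real) \<Rightarrow> 'i \<Rightarrow> real" where
  "coef f i = (LINT x:T|lborel. f x * e i x)"

text \<open>The Holder weight is moved to the right-hand side. Scaling functions will be assigned
  level 0, where the weight is 1, so one inequality covers both halves of the Holder norm.\<close>

definition density_ball :: "real \<Rightarrow> real \<Rightarrow> (real \<Rightarrow> real) set" where
  "density_ball B s = {f. (\<forall>x\<in>T. 0 \<le> f x) \<and> bounded (f ` T) \<and> continuous_on T f \<and>
     set_integrable lborel T f \<and> (LINT x:T|lborel. f x) = 1 \<and>
     (\<forall>i\<in>I. \<bar>coef f i\<bar> \<le> B * 2 powr (- (real (lev i) * (s + 1 / 2))))}"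

lemma T_borel [measurable, simp]: "T \<in> sets borel"
  using T_cases by auto

lemma sets_restrict: "sets (restrict_space lborel T) = sets (restrict_space borel T)"
  by (intro sets_restrict_space_cong) simp

lemma integral_restrict:
  fixes g :: "real \<Rightarrow> real"
  shows "(\<integral>x. g x \<partial>restrict_space lborel T) = (LINT x:T|lborel. g x)"
  by (subst integral_restrict_space) (auto simp: set_lebesgue_integral_def)

lemma integrable_restrict:
  fixes g :: "real \<Rightarrow> real"
  shows "integrable (restrict_space lborel T) g \<longleftrightarrow> set_integrable lborel T g"
  by (subst integrable_restrict_space) (auto simp: set_integrable_def)

lemma measurable_restrict:
  fixes g :: "real \<Rightarrow> real"
  shows "g \<in> borel_measurable (restrict_space borel T) \<longleftrightarrow> set_borel_measurable lborel T g"
proof -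
  have "g \<in> borel_measurable (restrict_space borel T) \<longleftrightarrow> g \<in> borel_measurable (restrict_space lborel T)"
    by (intro arg_cong2[of _ _ _ _ "(\<in>)"] measurable_cong_sets refl) (simp add: sets_restrict)
  also have "\<dots> \<longleftrightarrow> set_borel_measurable lborel T g"
    by (subst borel_measurable_restrict_space_iff) (auto simp: set_borel_measurable_def)
  finally show ?thesis .
qed

lemma measurable_e [measurable]: "i \<in> I \<Longrightarrow> e i \<in> borel_measurable (restrict_space borel T)"
  using basis by (auto simp: measurable_restrict orthonormal_basis_on_def orthonormal_on_def)

lemma e_bound:
  assumes "i \<in> I" "x \<in> T" shows "\<bar>e i x\<bar> \<le> M * sqrt 2 ^ lev i"
  using level_sum[of x "{i}" "lev i"] assms by simp

lemma exists_subinterval: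
  assumes "x \<in> T" "0 < d"
  obtains a b where "a < b" "{a<..<b} \<subseteq> T" "{a<..<b} \<subseteq> {x - d<..<x + d}"
proof (cases "T = UNIV")
  case True
  then show ?thesis using assms that[of "x - d" "x + d"] by auto
next
  case False
  then have "T = {0..1}" using T_cases by auto
  then have "0 \<le> x" "x \<le> 1" using assms by auto
  show ?thesis
  proof (rule that[of "max 0 (x - d)" "min 1 (x + d)"])
    show "max 0 (x - d) < min 1 (x + d)" using \<open>0 \<le> x\<close> \<open>x \<le> 1\<close> \<open>0 < d\<close> by auto
  qed (use \<open>T = {0..1}\<close> in auto)
qed

text \<open>A violation at \<open>x\<close> persists by continuity near \<open>x\<close>, and
  \<open>T\<close> contains a nondegenerate interval there, which has positive measure. At an end
  point of [0, 1] this interval lies on one side only.\<close>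

lemma AE_imp_everywhere_le:
  assumes h: "continuous_on T h" and ae: "AE x in lborel. x \<in> T \<longrightarrow> \<bar>h x\<bar> \<le> Q" and x: "x \<in> T"
  shows "\<bar>h x\<bar> \<le> (Q::real)"
proof (rule ccontr)
  assume "\<not> \<bar>h x\<bar> \<le> Q"
  then have "0 < \<bar>h x\<bar> - Q" by simp
  then obtain d where d: "0 < d" "\<And>y. y \<in> T \<Longrightarrow> dist y x < d \<Longrightarrow> dist (h y) (h x) < \<bar>h x\<bar> - Q"
    using h x unfolding continuous_on_iff by metis
  obtain a b where ab: "a < b" "{a<..<b} \<subseteq> T" "{a<..<b} \<subseteq> {x - d<..<x + d}"
    using exists_subinterval[OF x \<open>0 < d\<close>] .
  have "AE y in lborel. y \<notin> {a<..<b}"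
    using ae
  proof (rule AE_mp, intro AE_I2 impI notI)
    fix y assume y: "y \<in> T \<longrightarrow> \<bar>h y\<bar> \<le> Q" "y \<in> {a<..<b}"
    then have "y \<in> T" "y \<in> {x - d<..<x + d}" using ab by blast+
    then have "dist (h y) (h x) < \<bar>h x\<bar> - Q" by (intro d) (auto simp: dist_real_def)
    then show False using y \<open>y \<in> T\<close> by (auto simp: dist_real_def)
  qed
  then have "{a<..<b} \<in> null_sets lborel" by (subst AE_iff_null_sets) auto
  then show False using \<open>a < b\<close> by (auto simp: null_sets_def ennreal_eq_0_iff)
qed

text \<open>Bounded and integrable implies square integrable, which brings \<open>h\<close> within
  reach of completeness; continuity then removes the exceptional null set.\<close>

lemma abs_le_of_expansion:
  assumes h: "continuous_on T h" "bounded (h ` T)" "set_integrable lborel T h"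
    and Q: "\<And>x F. x \<in> T \<Longrightarrow> finite F \<Longrightarrow> F \<subseteq> I \<Longrightarrow> (\<Sum>i\<in>F. \<bar>coef h i * e i x\<bar>) \<le> Q"
    and x: "x \<in> T"
  shows "\<bar>h x\<bar> \<le> Q"
proof -
  let ?N = "restrict_space lborel T"
  have meas_eq: "borel_measurable ?N = borel_measurable (restrict_space borel T)"
    by (intro measurable_cong_sets sets_restrict refl)
  have hm: "h \<in> borel_measurable ?N"
    unfolding meas_eq by (rule borel_measurable_continuous_on_restrict) (rule h)
  obtain K where K: "\<And>x. x \<in> T \<Longrightarrow> \<bar>h x\<bar> \<le> K"
    using h(2) by (auto simp: bounded_iff)
  have h2: "integrable ?N (\<lambda>x. (h x)\<^sup>2)"
  proof (rule Bochner_Integration.integrable_bound)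
    show "integrable ?N (\<lambda>x. K * h x)" using h(3) by (simp add: integrable_restrict)
    show "AE x in ?N. norm ((h x)\<^sup>2) \<le> norm (K * h x)"
    proof (intro AE_I2)
      fix x assume "x \<in> space ?N"
      then have "\<bar>h x\<bar> \<le> \<bar>K\<bar>" using K[of x] by (auto simp: space_restrict_space)
      then have "\<bar>h x\<bar> * \<bar>h x\<bar> \<le> \<bar>K\<bar> * \<bar>h x\<bar>" by (rule mult_right_mono) auto
      then show "norm ((h x)\<^sup>2) \<le> norm (K * h x)" by (simp add: power2_eq_square abs_mult)
    qed
  qed (use hm in measurable)
  have "AE x in ?N. \<bar>h x\<bar> \<le> Q"
  proof (rule AE_bound_of_expansion[of I e, OF countable_I])
    show "e i \<in> borel_measurable ?N" if "i \<in> I" for i using measurable_e[OF that] by (simp add: meas_eq)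
    show "integrable ?N (e i)" if "i \<in> I" for i using integrable_e[OF that] by (simp add: integrable_restrict)
    show "(\<integral>x. e i x * e j x \<partial>?N) = (if i = j then 1 else 0)" if "i \<in> I" "j \<in> I" for i j
      using basis that by (simp add: integral_restrict orthonormal_basis_on_def orthonormal_on_def)
    show "AE x in ?N. f x = 0"
      if f: "f \<in> borel_measurable ?N" "integrable ?N (\<lambda>x. (f x)\<^sup>2)" "\<And>i. i \<in> I \<Longrightarrow> (\<integral>x. f x * e i x \<partial>?N) = 0" for f
      using basis f unfolding meas_eq measurable_restrict integrable_restrict integral_restrict orthonormal_basis_on_def
      by (subst AE_restrict_space_iff) auto
    show "(\<Sum>i\<in>F. \<bar>(\<integral>x. h x * e i x \<partial>?N) * e i x\<bar>) \<le> Q"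
      if "x \<in> space ?N" "finite F" "F \<subseteq> I" for x F
      using Q[of x F] that by (simp add: integral_restrict coef_def space_restrict_space)
  qed (fact hm h2)+
  then have "AE x in lborel. x \<in> T \<longrightarrow> \<bar>h x\<bar> \<le> Q" by (subst (asm) AE_restrict_space_iff) auto
  then show ?thesis using h(1) x by (intro AE_imp_everywhere_le)
qed

text \<open>Localisation turns a common coefficient bound \<open>b l\<close> on level
  \<open>l\<close> into a contribution of at most \<open>M * b l * sqrt 2 ^ l\<close> at every
  point, however many functions the level has. This is the usual domination of the supremum norm by
  a Besov-type sum over levels.\<close>

lemma abs_le_of_levels:
  assumes h: "continuous_on T h" "bounded (h ` T)" "set_integrable lborel T h"
    and b: "\<And>i. i \<in> I \<Longrightarrow> \<bar>coef h i\<bar> \<le> b (lev i)"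
    and Q: "\<And>P. (\<Sum>l<P. b l * sqrt 2 ^ l) \<le> Q" and b0: "\<And>l. 0 \<le> b l"
    and x: "x \<in> T"
  shows "\<bar>h x\<bar> \<le> M * Q"
proof (rule abs_le_of_expansion[OF h _ x])
  fix x F assume x: "x \<in> T" and F: "finite F" "F \<subseteq> I"
  obtain P where P: "lev ` F \<subseteq> {..<P}"
    using F finite_nat_bounded[of "lev ` F"] by blast
  have "(\<Sum>i\<in>F. \<bar>coef h i * e i x\<bar>) = (\<Sum>l<P. \<Sum>i\<in>{i\<in>F. lev i = l}. \<bar>coef h i * e i x\<bar>)"
    using F P by (intro sum.group[symmetric]) auto
  also have "\<dots> \<le> (\<Sum>l<P. \<Sum>i\<in>{i\<in>F. lev i = l}. b l * \<bar>e i x\<bar>)"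
    using b F by (intro sum_mono) (auto simp: abs_mult intro!: mult_right_mono)
  also have "\<dots> \<le> (\<Sum>l<P. b l * (M * sqrt 2 ^ l))"
    unfolding sum_distrib_left[symmetric] using F
    by (intro sum_mono mult_left_mono level_sum x b0) auto
  also have "\<dots> = M * (\<Sum>l<P. b l * sqrt 2 ^ l)" by (simp add: sum_distrib_left mult_ac)
  also have "\<dots> \<le> M * Q" using M_ge_1 Q by (intro mult_left_mono) auto
  finally show "(\<Sum>i\<in>F. \<bar>coef h i * e i x\<bar>) \<le> M * Q" .
qed

lemma level_weight:
  "2 powr (- (real l * (s + 1 / 2))) * sqrt 2 ^ l = (2 powr (- s)) ^ l"
proof -
  have "sqrt 2 ^ l = 2 powr (real l * (1 / 2))"
    by (simp add: powr_half_sqrt[symmetric] powr_realpow[symmetric] powr_powr)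
  then show ?thesis by (simp add: powr_add[symmetric] powr_realpow[symmetric] powr_powr algebra_simps)
qed

lemma density_ball_sup_le:
  assumes f: "f \<in> density_ball B s" and r: "0 < r" "r \<le> s" and B: "0 \<le> B" and x: "x \<in> T"
  shows "f x \<le> M * (B / (1 - 2 powr (- r)))"
proof -
  have "\<bar>f x\<bar> \<le> M * (B / (1 - 2 powr (- r)))"
  proof (rule abs_le_of_levels[where h = f and b = "\<lambda>l. B * 2 powr (- (real l * (s + 1 / 2)))"])
    fix P
    have "(\<Sum>l<P. B * 2 powr (- (real l * (s + 1 / 2))) * sqrt 2 ^ l) = B * (\<Sum>l<P. (2 powr (- s)) ^ l)"
      by (simp add: sum_distrib_left mult.assoc level_weight)
    \<comment> \<open>With threshold 1 every level counts as being above it.\<close>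
    also have "\<dots> \<le> B * (1 powr (- s) / (1 - 2 powr (- r)))"
      using r B by (intro mult_left_mono sum_geometric_above_threshold) auto
    finally show "(\<Sum>l<P. B * 2 powr (- (real l * (s + 1 / 2))) * sqrt 2 ^ l) \<le> B / (1 - 2 powr (- r))"
      by simp
  qed (use f B x in \<open>auto simp: density_ball_def\<close>)
  then show ?thesis by simp
qed

lemma coef_diff:
  assumes "f \<in> density_ball B s" "g \<in> density_ball B' t" "i \<in> I"
  shows "coef (\<lambda>x. f x - g x) i = coef f i - coef g i"
proof -
  have "set_integrable lborel T (\<lambda>x. u x * e i x)" if u: "u \<in> density_ball B s" for u B s
  proof -
    have "integrable (restrict_space lborel T) (\<lambda>x. e i x * u x)"
    proof (rule Bochner_Integration.integrable_bound)
      show "integrable (restrict_space lborel T) (\<lambda>x. M * sqrt 2 ^ lev i * u x)"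
        using u by (auto simp: density_ball_def integrable_restrict)
      have "u \<in> borel_measurable (restrict_space borel T)"
        using u by (intro borel_measurable_continuous_on_restrict) (auto simp: density_ball_def)
      then have "(\<lambda>x. e i x * u x) \<in> borel_measurable (restrict_space borel T)"
        using measurable_e[OF assms(3)] by measurable
      then show "(\<lambda>x. e i x * u x) \<in> borel_measurable (restrict_space lborel T)"
        by (simp add: measurable_cong_sets[OF sets_restrict refl])
      show "AE x in restrict_space lborel T. norm (e i x * u x) \<le> norm (M * sqrt 2 ^ lev i * u x)"
        using e_bound[OF assms(3)] M_ge_1
        by (intro AE_I2) (auto simp: space_restrict_space abs_mult intro!: mult_right_mono)
    qed
    then show ?thesis by (simp add: integrable_restrict mult.commute)
  qed
  from this[OF assms(1)] this[OF assms(2)] show ?thesis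
    by (simp add: coef_def left_diff_distrib)
qed

text \<open>Levels with \<open>2\<^sup>l \<le> N\<^bsup>1/(2s+1)\<^esup>\<close> are compared through \<open>\<delta>\<close>, the
  others through the decay of the coefficients.\<close>

lemma density_ball_close:
  assumes f: "f \<in> density_ball B s" and g: "g \<in> density_ball B t" and r: "0 < r" "r \<le> s" "s \<le> t"
    and B: "0 \<le> B" and N: "1 \<le> N" and \<delta>: "0 \<le> \<delta>"
    and close: "\<And>i. i \<in> I \<Longrightarrow> 2 ^ lev i \<le> N \<Longrightarrow> \<bar>coef f i - coef g i\<bar> \<le> \<delta>"
    and x: "x \<in> T"
  shows "\<bar>f x - g x\<bar> \<le> M * (4 * \<delta> * N powr (1 / (2 * (2 * s + 1)))
    + 2 * B / (1 - 2 powr (- r)) * N powr (- s / (2 * s + 1)))"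
proof -
  \<comment> \<open>The cutoff balances noise and bias: for \<delta> of order
    \<open>N powr (- 1 / 2)\<close> both \<open>\<delta> * sqrt p\<close> and
    \<open>p powr (- s)\<close> are of order \<open>N powr (- s / (2 * s + 1))\<close>. Since
    \<open>p \<le> N\<close>, hypothesis \<open>close\<close> covers all levels below the
    cutoff.\<close>
  define p where "p = N powr (1 / (2 * s + 1))"
  have p: "0 < p" "p \<le> N"
    using N r powr_mono[of "1 / (2 * s + 1)" 1 N] unfolding p_def by auto
  define b where "b l = (if 2 ^ l \<le> p then \<delta> else 2 * B * 2 powr (- (real l * (s + 1 / 2))))" for l :: nat
  show ?thesis
  proof (rule abs_le_of_levels[where b = b and h = "\<lambda>x. f x - g x"])
    show "continuous_on T (\<lambda>x. f x - g x)" using f g by (auto simp: density_ball_def intro!: continuous_intros)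
    show "bounded ((\<lambda>x. f x - g x) ` T)"
      using f g bounded_minus_comp[of f T g] by (auto simp: density_ball_def)
    show "set_integrable lborel T (\<lambda>x. f x - g x)" using f g by (auto simp: density_ball_def)
    show "0 \<le> b l" for l using \<delta> B by (simp add: b_def)
    show "\<bar>coef (\<lambda>x. f x - g x) i\<bar> \<le> b (lev i)" if i: "i \<in> I" for i
    proof (cases "2 ^ lev i \<le> p")
      case True
      then show ?thesis using close[OF i] p coef_diff[OF f g i] by (simp add: b_def)
    next
      case False
      have "2 powr (- (real (lev i) * (t + 1 / 2))) \<le> 2 powr (- (real (lev i) * (s + 1 / 2)))"
        \<comment> \<open>As \<open>s \<le> t\<close>, the coefficients of the smoother function
          \<open>g\<close> also satisfy the decay bound for \<open>s\<close>.\<close>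
        using r by (intro powr_mono) (auto intro!: mult_left_mono)
      then have "B * 2 powr (- (real (lev i) * (t + 1 / 2))) \<le> B * 2 powr (- (real (lev i) * (s + 1 / 2)))"
        using B by (rule mult_left_mono)
      moreover have "\<bar>coef g i\<bar> \<le> B * 2 powr (- (real (lev i) * (t + 1 / 2)))"
        using g i by (auto simp: density_ball_def)
      moreover have "\<bar>coef f i\<bar> \<le> B * 2 powr (- (real (lev i) * (s + 1 / 2)))"
        using f i by (auto simp: density_ball_def)
      ultimately have "\<bar>coef f i - coef g i\<bar> \<le> 2 * (B * 2 powr (- (real (lev i) * (s + 1 / 2))))"
        by linarith
      then show ?thesis using False coef_diff[OF f g i] by (simp add: b_def)
    qed
    fix P
    have "(\<Sum>l<P. b l * sqrt 2 ^ l)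
        = (\<Sum>l\<in>{l\<in>{..<P}. 2 ^ l \<le> p}. b l * sqrt 2 ^ l) + (\<Sum>l\<in>{l\<in>{..<P}. \<not> 2 ^ l \<le> p}. b l * sqrt 2 ^ l)"
      by (subst sum.union_disjoint[symmetric]) (auto intro: sum.cong)
    also have "(\<Sum>l\<in>{l\<in>{..<P}. 2 ^ l \<le> p}. b l * sqrt 2 ^ l) = \<delta> * (\<Sum>l\<in>{l\<in>{..<P}. 2 ^ l \<le> p}. sqrt 2 ^ l)"
      by (simp add: b_def sum_distrib_left)
    also have "\<dots> \<le> \<delta> * (4 * sqrt p)"
      using \<delta> p by (intro mult_left_mono sum_geometric_below_threshold) auto
    also have "(\<Sum>l\<in>{l\<in>{..<P}. \<not> 2 ^ l \<le> p}. b l * sqrt 2 ^ l)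
        = 2 * B * (\<Sum>l\<in>{l\<in>{..<P}. \<not> 2 ^ l \<le> p}. (2 powr (- s)) ^ l)"
      by (simp add: b_def sum_distrib_left mult.assoc level_weight)
    also have "\<dots> \<le> 2 * B * (p powr (- s) / (1 - 2 powr (- r)))"
      using r B p by (intro mult_left_mono sum_geometric_above_threshold) auto
    also have "\<delta> * (4 * sqrt p) = 4 * \<delta> * N powr (1 / (2 * (2 * s + 1)))"
      using r N by (simp add: p_def powr_half_sqrt[symmetric] powr_powr mult.commute)
    also have "p powr (- s) = N powr (- s / (2 * s + 1))"
      using r N by (simp add: p_def powr_powr)
    finally show "(\<Sum>l<P. b l * sqrt 2 ^ l) \<le> 4 * \<delta> * N powr (1 / (2 * (2 * s + 1)))
        + 2 * B / (1 - 2 powr (- r)) * N powr (- s / (2 * s + 1))"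
      by (simp add: b_def)
  qed (fact x)
qed

end

section \<open>Empirical coefficients under the product law of a density\<close>

context localized_basis
begin

definition law :: "(real \<Rightarrow> real) \<Rightarrow> real measure" where
  "law f = density (restrict_space lborel T) (\<lambda>x. ennreal (f x))"

definition empirical_coef :: "nat \<Rightarrow> (nat \<Rightarrow> real) \<Rightarrow> 'i \<Rightarrow> real" where
  "empirical_coef n X i = (\<Sum>j\<in>{1..n}. e i (X j)) / real n"

definition sup_const :: "real \<Rightarrow> real \<Rightarrow> real" where
  "sup_const B r = M * (B / (1 - 2 powr (- r)))"

definition noise_const :: "real \<Rightarrow> real \<Rightarrow> real" where
  "noise_const B r = 2 * M * (3 + sup_const B r / (4 * M\<^sup>2))"

lemma sup_const_nonneg: "0 \<le> B \<Longrightarrow> 0 < r \<Longrightarrow> 0 \<le> sup_const B r"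
  using M_ge_1 powr_less_one[of 2 "- r"] by (simp add: sup_const_def)

lemma sets_law: "sets (law f) = sets (restrict_space borel T)"
  by (simp add: law_def sets_restrict)

lemma space_law: "space (law f) = T"
  by (simp add: law_def space_restrict_space)

lemma density_ball_measurable:
  assumes "f \<in> density_ball B s" shows "f \<in> borel_measurable (restrict_space lborel T)"
proof -
  have "f \<in> borel_measurable (restrict_space borel T)"
    using assms by (intro borel_measurable_continuous_on_restrict) (auto simp: density_ball_def)
  then show ?thesis by (simp add: measurable_cong_sets[OF sets_restrict refl])
qed

lemma prob_space_law:
  assumes f: "f \<in> density_ball B s" shows "prob_space (law f)"
proof
  let ?N = "restrict_space lborel T"
  have [measurable]: "f \<in> borel_measurable ?N" using f by (rule density_ball_measurable)
  have "emeasure (law f) (space (law f)) = (\<integral>\<^sup>+x. ennreal (f x) * indicator (space ?N) x \<partial>?N)"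
    unfolding law_def space_density
  proof (rule emeasure_density)
    show "space ?N \<in> sets ?N" by (rule sets.top)
  qed measurable
  also have "\<dots> = (\<integral>\<^sup>+x. ennreal (f x) \<partial>?N)" by (rule nn_integral_cong) simp
  also have "\<dots> = ennreal (\<integral>x. f x \<partial>?N)"
    using f by (intro nn_integral_eq_integral AE_I2) (auto simp: density_ball_def integrable_restrict space_restrict_space)
  also have "\<dots> = 1" using f by (simp add: integral_restrict density_ball_def)
  finally show "emeasure (law f) (space (law f)) = 1" .
qed

lemma integral_law:
  fixes g :: "real \<Rightarrow> real"
  assumes f: "f \<in> density_ball B s" and g: "g \<in> borel_measurable (restrict_space borel T)"
  shows "(\<integral>x. g x \<partial>law f) = (LINT x:T|lborel. f x * g x)"
proof -
  have "g \<in> borel_measurable (restrict_space lborel T)"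
    using g by (simp add: measurable_cong_sets[OF sets_restrict refl])
  then have "(\<integral>x. g x \<partial>law f) = (\<integral>x. f x * g x \<partial>restrict_space lborel T)"
    using f density_ball_measurable[OF f] unfolding law_def
    by (subst integral_density) (auto simp: density_ball_def space_restrict_space intro!: AE_I2)
  then show ?thesis by (simp add: integral_restrict)
qed

lemma measurable_e_law: "i \<in> I \<Longrightarrow> e i \<in> borel_measurable (law f)"
  using measurable_e by (simp add: measurable_cong_sets[OF sets_law refl])

lemma expectation_e: "f \<in> density_ball B s \<Longrightarrow> i \<in> I \<Longrightarrow> (\<integral>x. e i x \<partial>law f) = coef f i"
  by (simp add: integral_law measurable_e coef_def)

text \<open>The density is bounded and \<open>e i\<close> has norm 1. This bound, uniform in
  \<open>i\<close>, controls the exponential factor of the deviation inequality, while the summed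
  bound below controls the linear factor.\<close>

lemma second_moment_le:
  assumes f: "f \<in> density_ball B s" and r: "0 < r" "r \<le> s" and B: "0 \<le> B" and i: "i \<in> I"
  shows "(\<integral>x. (e i x)\<^sup>2 \<partial>law f) \<le> sup_const B r"
proof -
  let ?N = "restrict_space lborel T"
  have norm1: "(LINT x:T|lborel. e i x * e i x) = 1"
    using basis i by (simp add: orthonormal_basis_on_def orthonormal_on_def)
  then have int: "integrable ?N (\<lambda>x. e i x * e i x)"
    using not_integrable_integral_eq[of ?N "\<lambda>x. e i x * e i x"] by (auto simp: integral_restrict)
  have m: "e i \<in> borel_measurable ?N"
    using measurable_e[OF i] by (simp add: measurable_cong_sets[OF sets_restrict refl])
  have le: "f x * (e i x * e i x) \<le> sup_const B r * (e i x * e i x)" if "x \<in> T" for x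
    using density_ball_sup_le[OF f r B that] by (intro mult_right_mono) (auto simp: sup_const_def)
  have "(\<integral>x. (e i x)\<^sup>2 \<partial>law f) = (\<integral>x. f x * (e i x * e i x) \<partial>?N)"
    using measurable_e[OF i] by (subst integral_law[OF f]) (auto simp: integral_restrict power2_eq_square)
  also have "\<dots> \<le> (\<integral>x. sup_const B r * (e i x * e i x) \<partial>?N)"
  proof (rule integral_mono)
    show "integrable ?N (\<lambda>x. f x * (e i x * e i x))"
    proof (rule Bochner_Integration.integrable_bound)
      show "integrable ?N (\<lambda>x. sup_const B r * (e i x * e i x))" using int by simp
      show "AE x in ?N. norm (f x * (e i x * e i x)) \<le> norm (sup_const B r * (e i x * e i x))"
      proof (rule AE_I2)
        fix x assume "x \<in> space ?N"
        then have "x \<in> T" by (simp add: space_restrict_space)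
        moreover then have "0 \<le> f x" using f by (auto simp: density_ball_def)
        ultimately show "norm (f x * (e i x * e i x)) \<le> norm (sup_const B r * (e i x * e i x))"
          using le[of x] sup_const_nonneg[OF B \<open>0 < r\<close>] by (simp add: abs_mult)
      qed
    qed (use m density_ball_measurable[OF f] in measurable)
  qed (use int le in \<open>auto simp: space_restrict_space\<close>)
  also have "\<dots> = sup_const B r" using norm1 by (simp add: integral_restrict)
  finally show ?thesis .
qed

text \<open>At a point the squares on level \<open>l\<close> sum to at most the largest absolute
  value times the sum of absolute values, hence to at most \<open>M^2 * 2 ^ l\<close>. The number of
  functions never enters, and integrating a constant against a probability law costs
  nothing.\<close>

lemma sum_second_moments_le:
  assumes f: "f \<in> density_ball B s" and N: "0 \<le> N" and F: "finite F" "F \<subseteq> {i\<in>I. 2 ^ lev i \<le> N}"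
  shows "(\<Sum>i\<in>F. \<integral>x. (e i x)\<^sup>2 \<partial>law f) \<le> 2 * M\<^sup>2 * N"
proof -
  interpret prob_space "law f" using f by (rule prob_space_law)
  have FI: "i \<in> I" if "i \<in> F" for i using F that by auto
  have pt: "(\<Sum>i\<in>F. (e i x)\<^sup>2) \<le> 2 * M\<^sup>2 * N" if x: "x \<in> T" for x
  proof -
    have "(\<Sum>i\<in>F. (e i x)\<^sup>2) = (\<Sum>l\<in>lev ` F. \<Sum>i\<in>{i\<in>F. lev i = l}. (e i x)\<^sup>2)"
      using F by (intro sum.group[symmetric]) auto
    also have "\<dots> \<le> (\<Sum>l\<in>lev ` F. M\<^sup>2 * 2 ^ l)"
    proof (rule sum_mono)
      fix l
      have "(\<Sum>i\<in>{i\<in>F. lev i = l}. (e i x)\<^sup>2) \<le> (\<Sum>i\<in>{i\<in>F. lev i = l}. (M * sqrt 2 ^ l) * \<bar>e i x\<bar>)"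
      proof (rule sum_mono)
        fix i assume "i \<in> {i\<in>F. lev i = l}"
        then have "\<bar>e i x\<bar> * \<bar>e i x\<bar> \<le> (M * sqrt 2 ^ l) * \<bar>e i x\<bar>"
          using e_bound[OF FI x] by (intro mult_right_mono) auto
        then show "(e i x)\<^sup>2 \<le> (M * sqrt 2 ^ l) * \<bar>e i x\<bar>" by (simp add: power2_eq_square flip: abs_mult)
      qed
      also have "\<dots> \<le> (M * sqrt 2 ^ l) * (M * sqrt 2 ^ l)"
        unfolding sum_distrib_left[symmetric]
        using M_ge_1 F FI by (intro mult_left_mono level_sum x) auto
      also have "\<dots> = M\<^sup>2 * 2 ^ l"
        by (simp add: power2_eq_square flip: power_mult_distrib)
      finally show "(\<Sum>i\<in>{i\<in>F. lev i = l}. (e i x)\<^sup>2) \<le> M\<^sup>2 * 2 ^ l" .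
    qed
    also have "\<dots> = M\<^sup>2 * (\<Sum>l\<in>lev ` F. 2 ^ l)" by (simp add: sum_distrib_left)
    also have "\<dots> \<le> M\<^sup>2 * (2 * N)"
      using F N by (intro mult_left_mono sum_power2_below_threshold) auto
    finally show ?thesis by simp
  qed
  have int: "integrable (law f) (\<lambda>x. (e i x)\<^sup>2)" if "i \<in> F" for i
  proof (rule integrable_const_bound)
    show "AE x in law f. norm ((e i x)\<^sup>2) \<le> (M * sqrt 2 ^ lev i)\<^sup>2"
      using e_bound[OF FI[OF that]]
      by (intro AE_I2) (auto simp: space_law simp flip: abs_le_square_iff intro!: abs_le_square_iff[THEN iffD1] order_trans[OF _ abs_ge_self])
  qed (use measurable_e_law[OF FI[OF that]] in measurable)
  have "(\<Sum>i\<in>F. \<integral>x. (e i x)\<^sup>2 \<partial>law f) = (\<integral>x. (\<Sum>i\<in>F. (e i x)\<^sup>2) \<partial>law f)"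
    using int by (subst Bochner_Integration.integral_sum) auto
  also have "\<dots> \<le> (\<integral>x. 2 * M\<^sup>2 * N \<partial>law f)"
    using int pt by (intro integral_mono) (auto simp: space_law)
  also have "\<dots> = 2 * M\<^sup>2 * N" by (simp add: prob_space)
  finally show ?thesis .
qed

lemma sample_law_eq: "sample_law T f n = (\<Pi>\<^sub>M j\<in>{1..n}. law f)"
  by (simp add: sample_law_def law_def)

lemma sets_sample_law: "sets (sample_law T f n) = sets (sample_space T n)"
  unfolding sample_law_eq sample_space_def by (intro sets_PiM_cong refl) (simp add: sets_law)

lemma space_sample_law: "space (sample_law T f n) = space (sample_space T n)"
  by (intro sets_eq_imp_space_eq sets_sample_law)

lemma prob_space_sample_law: "f \<in> density_ball B s \<Longrightarrow> prob_space (sample_law T f n)"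
  unfolding sample_law_eq by (intro prob_space_PiM prob_space_law)

text \<open>The probability of a deviation at \<open>i\<close> is at most
  \<open>ln n / (n^3 * M^2)\<close> times the second moment of \<open>e i\<close>; summing the
  second moments leaves \<open>2 / n^2\<close>, which is at most \<open>1 / n\<close>. Exhibiting
  the exceptional set as a measurable \<open>Bad\<close> makes everything afterwards
  deterministic.\<close>

lemma empirical_deviation:
  assumes f: "f \<in> density_ball B s" and r: "0 < r" "r \<le> s" and B: "0 \<le> B" and n: "2 \<le> n"
  obtains Bad where "Bad \<in> sets (sample_space T n)" "measure (sample_law T f n) Bad \<le> 1 / real n"
    "\<And>X i. X \<in> space (sample_space T n) - Bad \<Longrightarrow> i \<in> I \<Longrightarrow> 2 ^ lev i \<le> real n / ln (real n) \<Longrightarrow>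
       \<bar>empirical_coef n X i - coef f i\<bar> \<le> noise_const B r * sqrt (ln (real n) / real n)"
proof -
  interpret L: prob_space "law f" using f by (rule prob_space_law)
  let ?P = "\<Pi>\<^sub>M j\<in>{1..n}. law f"
  interpret P: prob_space ?P by (intro prob_space_PiM prob_space_law[OF f])
  define D where "D = sup_const B r"
  define \<tau> where "\<tau> = noise_const B r"
  define \<epsilon> where "\<epsilon> = sqrt (ln (real n) / real n)"
  define N where "N = real n / ln (real n)"
  define K where "K = {i\<in>I. 2 ^ lev i \<le> N}"
  define \<theta> where "\<theta> = \<epsilon> / (2 * M)"
  define t where "t = real n * (\<tau> * \<epsilon>)"
  define A where "A i = {X \<in> space ?P. t \<le> \<bar>\<Sum>j\<in>{1..n}. e i (X j) - (\<integral>x. e i x \<partial>law f)\<bar>}" for i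
  have ln: "0 < ln (real n)" using n by simp
  have n0: "0 < real n" using n by simp
  have D0: "0 \<le> D" using sup_const_nonneg[OF B r(1)] by (simp add: D_def)
  have \<tau>: "\<tau> = 2 * M * (3 + D / (4 * M\<^sup>2))" "0 \<le> \<tau>"
    using D0 M_ge_1 by (simp_all add: \<tau>_def D_def noise_const_def)
  have \<epsilon>2: "\<epsilon>\<^sup>2 = ln (real n) / real n" "0 < \<epsilon>" using ln n0 by (auto simp: \<epsilon>_def)
  have N0: "0 < N" using ln n0 by (simp add: N_def)
  have \<theta>0: "0 \<le> \<theta>" using \<epsilon>2 M_ge_1 by (simp add: \<theta>_def)
  have t0: "0 \<le> t" using \<epsilon>2 \<tau> by (simp add: t_def)
  \<comment> \<open>\<open>noise_const\<close> is chosen so that \<open>exp (\<theta> * t) = n\<^sup>3 * exp (n * \<theta>\<^sup>2 * D)\<close>, where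
    \<open>D\<close> bounds the second moments.\<close>
  define a where "a = (3 + D / (4 * M\<^sup>2)) * ln (real n)"
  have a: "\<theta> * t = a"
  proof -
    have "\<theta> * t = \<epsilon>\<^sup>2 * real n * (\<tau> / (2 * M))" by (simp add: \<theta>_def t_def power2_eq_square)
    also have "\<dots> = a" using M_ge_1 n0 by (simp add: \<epsilon>2 a_def \<tau>)
    finally show ?thesis .
  qed
  \<comment> \<open>\<open>cosh a - 1 \<ge> exp a / 2 - 1\<close>, which is at least
    \<open>exp a / 4\<close> once \<open>exp a \<ge> 4\<close>; already \<open>n \<ge> 2\<close>
    gives \<open>exp a \<ge> 8\<close>.\<close>
  have cosh: "exp a / 4 \<le> cosh (\<theta> * t) - 1"
  proof -
    have "3 * ln 2 \<le> a"
      unfolding a_def using D0 n M_ge_1 by (intro mult_mono) auto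
    have "(8::real) = exp (3 * ln 2)" by (simp add: exp_of_nat_mult[of 3 "ln 2", simplified])
    also have "\<dots> \<le> exp a" using \<open>3 * ln 2 \<le> a\<close> by simp
    finally show ?thesis unfolding a cosh_field_def using exp_ge_zero[of "-a"] by argo
  qed
  have single: "measure ?P (A i) \<le> ln (real n) / (real n ^ 3 * M\<^sup>2) * (\<integral>x. (e i x)\<^sup>2 \<partial>law f)"
    if i: "i \<in> K" for i
  proof -
    have iI: "i \<in> I" and lev: "2 ^ lev i \<le> N" using i by (auto simp: K_def)
    define v where "v = (\<integral>x. (e i x)\<^sup>2 \<partial>law f)"
    have v: "0 \<le> v" "v \<le> D" using second_moment_le[OF f r B iI] by (auto simp: v_def D_def)
    define w where "w = real n * \<theta>\<^sup>2 * v"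
    have w: "w = ln (real n) / (4 * M\<^sup>2) * v"
      using n0 by (simp add: w_def \<theta>_def power_divide \<epsilon>2 power_mult_distrib)
    have w0: "0 \<le> w" using v ln by (simp add: w)
    have wle: "w \<le> ln (real n) * (D / (4 * M\<^sup>2))"
      unfolding w using v ln M_ge_1 by (simp add: divide_right_mono mult_left_mono)
    have "2 * \<theta> * (M * sqrt 2 ^ lev i) = \<epsilon> * sqrt (2 ^ lev i)"
      using M_ge_1 by (simp add: \<theta>_def real_sqrt_power)
    also have "\<dots> \<le> \<epsilon> * sqrt N" using lev \<epsilon>2 by (intro mult_left_mono) auto
    also have "\<dots> = 1" using ln n0 by (simp add: \<epsilon>_def N_def real_sqrt_divide)
    finally have "(cosh (\<theta> * t) - 1) * measure ?P (A i) \<le> w * exp w"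
      using L.iid_sum_deviation[of "e i" "M * sqrt 2 ^ lev i" "{1..n}" \<theta> t]
        measurable_e_law[OF iI, of f] e_bound[OF iI] \<theta>0 t0
      by (auto simp: space_law A_def w_def v_def)
    moreover have "exp a / 4 * measure ?P (A i) \<le> (cosh (\<theta> * t) - 1) * measure ?P (A i)"
      using cosh by (intro mult_right_mono) auto
    moreover have "w * exp w \<le> w * exp (ln (real n) * (D / (4 * M\<^sup>2)))"
      using w0 wle by (intro mult_left_mono) auto
    ultimately have le: "exp a / 4 * measure ?P (A i) \<le> w * exp (ln (real n) * (D / (4 * M\<^sup>2)))"
      by linarith
    \<comment> \<open>The second factor is also the bound for \<open>exp w\<close>; it cancels and
      leaves the power of \<open>n\<close>.\<close>
    have "exp a = real n ^ 3 * exp (ln (real n) * (D / (4 * M\<^sup>2)))"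
    proof -
      have "a = ln (real n ^ 3) + ln (real n) * (D / (4 * M\<^sup>2))"
        using n0 by (simp add: a_def ln_realpow algebra_simps)
      then show ?thesis using n0 by (simp add: exp_add)
    qed
    then have "real n ^ 3 * measure ?P (A i) * exp (ln (real n) * (D / (4 * M\<^sup>2)))
        = 4 * (exp a / 4 * measure ?P (A i))" by simp
    also have "\<dots> \<le> 4 * (w * exp (ln (real n) * (D / (4 * M\<^sup>2))))"
      using le by (intro mult_left_mono) auto
    finally have "real n ^ 3 * measure ?P (A i) * exp (ln (real n) * (D / (4 * M\<^sup>2)))
        \<le> 4 * w * exp (ln (real n) * (D / (4 * M\<^sup>2)))" by (simp only: mult.assoc)
    then have "real n ^ 3 * measure ?P (A i) \<le> 4 * w"
      by (rule mult_right_le_imp_le) simp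
    then have "measure ?P (A i) \<le> 4 * w / real n ^ 3"
      using n0 by (simp add: pos_le_divide_eq mult.commute)
    also have "\<dots> = ln (real n) / (real n ^ 3 * M\<^sup>2) * v" by (simp add: w)
    finally show ?thesis by (simp add: v_def)
  qed
  have KI: "i \<in> I" if "i \<in> K" for i using that by (simp add: K_def)
  have A_sets: "A i \<in> sets ?P" if "i \<in> K" for i
  proof -
    have [measurable]: "e i \<in> borel_measurable (law f)" by (intro measurable_e_law KI that)
    show ?thesis unfolding A_def by measurable
  qed
  have bound: "measure ?P (\<Union>i\<in>K. A i) \<le> 1 / real n"
  proof (rule P.measure_countable_UN_le)
    show "countable K" using countable_I by (rule countable_subset[rotated]) (auto simp: K_def)
    show "measure ?P (\<Union>i\<in>F. A i) \<le> 1 / real n" if F: "finite F" "F \<subseteq> K" for F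
    proof -
      have "measure ?P (\<Union>i\<in>F. A i) \<le> (\<Sum>i\<in>F. measure ?P (A i))"
        using F A_sets by (intro P.finite_measure_subadditive_finite) auto
      also have "\<dots> \<le> (\<Sum>i\<in>F. ln (real n) / (real n ^ 3 * M\<^sup>2) * (\<integral>x. (e i x)\<^sup>2 \<partial>law f))"
        using F single by (intro sum_mono) auto
      also have "\<dots> \<le> ln (real n) / (real n ^ 3 * M\<^sup>2) * (2 * M\<^sup>2 * N)"
        unfolding sum_distrib_left[symmetric] using ln N0 F
        by (intro mult_left_mono sum_second_moments_le[OF f]) (auto simp: K_def)
      also have "\<dots> = 2 / (real n * real n)"
        using ln n0 M_ge_1 by (simp add: N_def power3_eq_cube)
      also have "\<dots> \<le> 1 / real n" using n by (simp add: divide_simps)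
      finally show ?thesis .
    qed
  qed (rule A_sets)
  show thesis
  proof (rule that)
    show "(\<Union>i\<in>K. A i) \<in> sets (sample_space T n)"
      unfolding sets_sample_law[of f n, symmetric] sample_law_eq
    proof (rule sets.countable_UN')
      show "countable K" using countable_I by (rule countable_subset[rotated]) (auto simp: K_def)
    qed (use A_sets in auto)
    show "measure (sample_law T f n) (\<Union>i\<in>K. A i) \<le> 1 / real n" using bound by (simp add: sample_law_eq)
    fix X i assume X: "X \<in> space (sample_space T n) - (\<Union>i\<in>K. A i)" and i: "i \<in> I"
      and "2 ^ lev i \<le> real n / ln (real n)"
    then have "i \<in> K" by (simp add: K_def N_def)
    then have "X \<notin> A i" using X by blast
    moreover have "X \<in> space ?P" using X by (simp flip: space_sample_law[of f] add: sample_law_eq)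
    ultimately have "\<bar>\<Sum>j\<in>{1..n}. e i (X j) - coef f i\<bar> \<le> t"
      by (simp add: A_def expectation_e[OF f i])
    moreover have "(\<Sum>j\<in>{1..n}. e i (X j) - coef f i) = real n * (empirical_coef n X i - coef f i)"
      using n0 by (simp add: sum_subtractf empirical_coef_def field_simps)
    ultimately show "\<bar>empirical_coef n X i - coef f i\<bar> \<le> noise_const B r * sqrt (ln (real n) / real n)"
      using n0 by (simp add: abs_mult t_def \<tau>_def \<epsilon>_def)
  qed
qed

end

section \<open>The confidence band\<close>

text \<open>
  The band depends on the sample only through a rounded version of it, which takes countably
  many values. Hence every function of it is measurable, including choices made with \<open>SOME\<close>.
\<close>

definition round_sample :: "nat \<Rightarrow> nat \<Rightarrow> (nat \<Rightarrow> real) \<Rightarrow> nat \<Rightarrow> real" where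
  "round_sample N n X = (\<lambda>j\<in>{1..n}. of_int \<lfloor>real N * X j\<rfloor> / real N)"

lemma measurable_round_sample:
  "(\<lambda>X. F (round_sample N n X)) \<in> measurable (sample_space T n) (count_space UNIV)"
proof -
  define A where "A = (\<Pi>\<^sub>E j\<in>{1..n}. range (\<lambda>z. real_of_int z / real N))"
  have "countable A" unfolding A_def by (intro countable_PiE) auto
  have maps: "round_sample N n \<in> space (sample_space T n) \<rightarrow> A"
    by (auto simp: A_def round_sample_def)
  have "round_sample N n -` {a} \<inter> space (sample_space T n) \<in> sets (sample_space T n)" if a: "a \<in> A" for a
  proof -
    have "round_sample N n -` {a} \<inter> space (sample_space T n)
        = {X \<in> space (sample_space T n). \<forall>j\<in>{1..n}. of_int \<lfloor>real N * X j\<rfloor> / real N = a j}"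
      using a by (auto simp: A_def round_sample_def fun_eq_iff PiE_def extensional_def)
    moreover have "{X \<in> space (sample_space T n). of_int \<lfloor>real N * X j\<rfloor> / real N = a j} \<in> sets (sample_space T n)"
      if j: "j \<in> {1..n}" for j
    proof -
      have "(\<lambda>X. X j) \<in> measurable (sample_space T n) (restrict_space borel T)"
        unfolding sample_space_def using j by measurable
      then have [measurable]: "(\<lambda>X. X j) \<in> borel_measurable (sample_space T n)"
        by (rule measurable_restrict_space2_iff[THEN iffD1, THEN conjunct1])
      show ?thesis by measurable
    qed
    ultimately show ?thesis by (auto intro: sets.sets_Collect_finite_All')
  qed
  then have "round_sample N n \<in> measurable (sample_space T n) (count_space A)"
    using maps \<open>countable A\<close> by (subst measurable_count_space_eq_countable) auto
  moreover have "F \<in> measurable (count_space A) (count_space UNIV)" by simp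
  ultimately show ?thesis by (rule measurable_compose)
qed

context localized_basis
begin

text \<open>Rounding is downwards and 0 is a lattice point, so [0, 1] is not left. This matters
  because continuity of the basis functions is known only on \<open>T\<close>.\<close>

lemma round_in_T: "x \<in> T \<Longrightarrow> 0 < N \<Longrightarrow> of_int \<lfloor>real N * x\<rfloor> / real N \<in> T"
proof (cases "T = UNIV")
  case False
  assume x: "x \<in> T" and N: "0 < N"
  have T: "T = {0..1}" using False T_cases by auto
  have "real_of_int \<lfloor>real N * x\<rfloor> \<le> real N * x" by simp
  also have "\<dots> \<le> real N * 1" using x T by (intro mult_left_mono) auto
  finally show ?thesis using x N T by (auto simp: divide_simps)
qed simp

lemma equicontinuous_below:
  assumes "0 < \<delta>"
  shows "\<exists>d>0. \<forall>i\<in>I. lev i < L \<longrightarrow> (\<forall>x\<in>T. \<forall>y\<in>T. \<bar>x - y\<bar> < d \<longrightarrow> \<bar>e i x - e i y\<bar> \<le> \<delta>)"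
proof (induction L)
  case (Suc L)
  then obtain d1 where d1: "d1 > 0"
    "\<forall>i\<in>I. lev i < L \<longrightarrow> (\<forall>x\<in>T. \<forall>y\<in>T. \<bar>x - y\<bar> < d1 \<longrightarrow> \<bar>e i x - e i y\<bar> \<le> \<delta>)" by auto
  obtain d2 where d2: "d2 > 0"
    "\<forall>i\<in>I. lev i = L \<longrightarrow> (\<forall>x\<in>T. \<forall>y\<in>T. \<bar>x - y\<bar> < d2 \<longrightarrow> \<bar>e i x - e i y\<bar> \<le> \<delta>)"
    using equicontinuous[OF assms] by blast
  show ?case using d1 d2 by (intro exI[of _ "min d1 d2"]) (auto simp: less_Suc_eq)
qed (auto intro: exI[of _ 1])

text \<open>Only finitely many levels satisfy \<open>2 ^ lev i \<le> P\<close>, and each is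
  equicontinuous uniformly over its functions. Hence one deterministic mesh works for all samples
  and all these indices.\<close>

lemma exists_mesh:
  fixes P :: real
  assumes \<delta>: "0 < \<delta>"
  shows "\<exists>N>0. \<forall>X\<in>space (sample_space T n). \<forall>i\<in>I. 2 ^ lev i \<le> P \<longrightarrow>
    \<bar>empirical_coef n (round_sample N n X) i - empirical_coef n X i\<bar> \<le> \<delta>"
proof -
  obtain L :: nat where L: "P < 2 ^ L" using real_arch_pow[of 2 P] by auto
  obtain d where d: "d > 0"
    "\<forall>i\<in>I. lev i < L \<longrightarrow> (\<forall>x\<in>T. \<forall>y\<in>T. \<bar>x - y\<bar> < d \<longrightarrow> \<bar>e i x - e i y\<bar> \<le> \<delta>)"
    using equicontinuous_below[OF \<delta>] by blast
  obtain N :: nat where N: "0 < N" "1 / real N < d"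
    using reals_Archimedean[OF d(1)] by (metis inverse_eq_divide zero_less_Suc)
  have "\<bar>empirical_coef n (round_sample N n X) i - empirical_coef n X i\<bar> \<le> \<delta>"
    if X: "X \<in> space (sample_space T n)" and i: "i \<in> I" "2 ^ lev i \<le> P" for X i
  proof -
    have "(2::real) ^ lev i < 2 ^ L" using i L by linarith
    then have lev: "lev i < L" by simp
    have each: "\<bar>e i (round_sample N n X j) - e i (X j)\<bar> \<le> \<delta>" if j: "j \<in> {1..n}" for j
    proof -
      have XT: "X j \<in> T" using X j by (auto simp: sample_space_def space_PiM space_restrict_space PiE_def Pi_def)
      let ?z = "real_of_int \<lfloor>real N * X j\<rfloor>"
      have "?z \<le> real N * X j" "real N * X j < ?z + 1" by linarith+
      then have "\<bar>?z - real N * X j\<bar> \<le> 1" by linarith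
      then have "\<bar>?z - real N * X j\<bar> / real N \<le> 1 / real N" by (rule divide_right_mono) simp
      moreover have "?z / real N - X j = (?z - real N * X j) / real N" using N by (simp add: diff_divide_distrib)
      ultimately have "\<bar>?z / real N - X j\<bar> \<le> 1 / real N" by simp
      then show ?thesis using d(2) i(1) lev XT round_in_T[OF XT N(1)] N j
        by (auto simp: round_sample_def)
    qed
    have "\<bar>empirical_coef n (round_sample N n X) i - empirical_coef n X i\<bar>
        = \<bar>\<Sum>j\<in>{1..n}. e i (round_sample N n X j) - e i (X j)\<bar> / real n"
      by (simp add: empirical_coef_def sum_subtractf diff_divide_distrib[symmetric])
    also have "\<dots> \<le> (\<Sum>j\<in>{1..n}. \<bar>e i (round_sample N n X j) - e i (X j)\<bar>) / real n"
      by (intro divide_right_mono sum_abs) auto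
    also have "\<dots> \<le> (real n * \<delta>) / real n"
      using sum_bounded_above[of "{1..n}" _ \<delta>] each by (intro divide_right_mono) auto
    also have "\<dots> \<le> \<delta>" using \<delta> by simp
    finally show ?thesis .
  qed
  then show ?thesis using N by blast
qed

end

section \<open>Elementary bounds for the rate\<close>

lemma rate_nonneg: "0 \<le> rate n s"
  by (simp add: rate_def)

lemma rate_pos: "2 \<le> n \<Longrightarrow> 0 < rate n s"
  by (simp add: rate_def)

lemma ln_div_le_1: "1 \<le> n \<Longrightarrow> ln (real n) / real n \<le> 1"
  using ln_le_minus_one[of "real n"] by (simp add: divide_simps)

lemma rate_le_1: "0 \<le> s \<Longrightarrow> rate n s \<le> 1"
proof (cases "n = 0")
  case False
  then show "0 \<le> s \<Longrightarrow> rate n s \<le> 1"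
    unfolding rate_def using ln_div_le_1[of n] by (intro powr_le1) auto
qed (simp add: rate_def)

text \<open>The exponent of the rate is at most 1/2, so it suffices to compare \<open>1 / n\<close>
  with \<open>sqrt (ln n / n)\<close>. This absorbs the exceptional event into the expected
  diameter.\<close>

lemma inverse_le_rate:
  assumes n: "2 \<le> n" and s: "0 \<le> s"
  shows "1 / real n \<le> rate n s"
proof -
  have "1 / 2 \<le> ln (2::real)" using ln_le_minus_one[of "1 / 2 :: real"] by (simp add: ln_div)
  also have "\<dots> \<le> ln (real n)" using n by simp
  finally have ln: "1 / 2 \<le> ln (real n)" .
  have "1 \<le> real n * (1 / 2)" using n by simp
  also have "\<dots> \<le> real n * ln (real n)" using ln by (intro mult_left_mono) auto
  finally have "1 / real n / real n \<le> ln (real n) / real n"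
    using n by (intro divide_right_mono) (auto simp: field_simps)
  then have "(1 / real n)\<^sup>2 \<le> ln (real n) / real n" by (simp add: power2_eq_square)
  then have "1 / real n \<le> sqrt (ln (real n) / real n)" by (rule real_le_rsqrt)
  also have "\<dots> = (ln (real n) / real n) powr (1 / 2)" using n by (simp add: powr_half_sqrt)
  also have "\<dots> \<le> rate n s"
    unfolding rate_def using n s ln_div_le_1[of n] by (intro powr_mono') (auto simp: divide_simps)
  finally show ?thesis .
qed

text \<open>\<open>H\<close> stands for the Holder balls: feasibility and separation refer to the
  same classes \<open>H t\<close>, while the estimates use only the coefficient decay given by
  \<open>H_ball\<close>.\<close>

locale band_construction = localized_basis T I e lev M
  for T :: "real set" and I :: "'i set" and e lev M +
  fixes H :: "real \<Rightarrow> (real \<Rightarrow> real) set" and B r :: real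
  assumes r_pos: "0 < r" and B_nonneg: "0 \<le> B"
    and H_ball: "\<And>s. r \<le> s \<Longrightarrow> H s \<subseteq> density_ball B s"
begin

definition noise :: "nat \<Rightarrow> real" where
  "noise n = noise_const B r * sqrt (ln (real n) / real n)"

text \<open>The tolerance has one \<open>noise n\<close> for the sampling error and one for
  rounding, since \<open>x\<close> will be a rounded sample.\<close>

definition feasible :: "nat \<Rightarrow> (nat \<Rightarrow> real) \<Rightarrow> real \<Rightarrow> (real \<Rightarrow> real) \<Rightarrow> bool" where
  "feasible n x t g \<longleftrightarrow> g \<in> H t \<and>
     (\<forall>i\<in>I. 2 ^ lev i \<le> real n / ln (real n) \<longrightarrow> \<bar>empirical_coef n x i - coef g i\<bar> \<le> 2 * noise n)"

text \<open>The default \<open>r\<close> keeps the value at least \<open>r\<close> over a finite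
  grid, so the radius stays bounded even on the exceptional event.\<close>

definition smoothness :: "real set \<Rightarrow> nat \<Rightarrow> (nat \<Rightarrow> real) \<Rightarrow> real" where
  "smoothness G n x =
     (if \<exists>t\<in>G. \<exists>g. feasible n x t g then Max {t\<in>G. \<exists>g. feasible n x t g} else r)"

text \<open>If nothing is feasible this is an arbitrary function; coverage may then fail, but the
  width of the band is unaffected.\<close>

definition centre :: "real set \<Rightarrow> nat \<Rightarrow> (nat \<Rightarrow> real) \<Rightarrow> real \<Rightarrow> real" where
  "centre G n x = (SOME g. feasible n x (smoothness G n x) g)"

text \<open>16 is 4 from the geometric sum over coarse levels times 4, as two feasible functions
  have coefficients within \<open>4 * noise n\<close>. The second summand is the tail of the fine
  levels.\<close>

definition radius_const :: real where
  "radius_const = M * (16 * noise_const B r + 2 * B / (1 - 2 powr (- r)))"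

definition mesh :: "nat \<Rightarrow> nat" where
  "mesh n = (SOME N. 0 < N \<and> (\<forall>X\<in>space (sample_space T n). \<forall>i\<in>I. 2 ^ lev i \<le> real n / ln (real n) \<longrightarrow>
     \<bar>empirical_coef n (round_sample N n X) i - empirical_coef n X i\<bar> \<le> noise n))"

definition rounded :: "nat \<Rightarrow> (nat \<Rightarrow> real) \<Rightarrow> nat \<Rightarrow> real" where
  "rounded n = round_sample (mesh n) n"

definition lower :: "real set \<Rightarrow> nat \<Rightarrow> (nat \<Rightarrow> real) \<Rightarrow> real \<Rightarrow> real" where
  "lower G n X y = centre G n (rounded n X) y - radius_const * rate n (smoothness G n (rounded n X))"

definition upper :: "real set \<Rightarrow> nat \<Rightarrow> (nat \<Rightarrow> real) \<Rightarrow> real \<Rightarrow> real" where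
  "upper G n X y = centre G n (rounded n X) y + radius_const * rate n (smoothness G n (rounded n X))"

lemma noise_const_ge: "6 \<le> noise_const B r"
proof -
  have "2 * 1 * 3 \<le> 2 * M * (3 + sup_const B r / (4 * M\<^sup>2))"
    using M_ge_1 sup_const_nonneg[OF B_nonneg r_pos] by (intro mult_mono) auto
  then show ?thesis by (simp add: noise_const_def)
qed

lemma radius_const_nonneg: "0 \<le> radius_const"
  using M_ge_1 noise_const_ge B_nonneg powr_less_one[of 2 "- r"] r_pos by (simp add: radius_const_def)

lemma measurable_rounded:
  "(\<lambda>X. F (rounded n X)) \<in> measurable (sample_space T n) (count_space UNIV)"
  unfolding rounded_def by (rule measurable_round_sample)

text \<open>The cover event and the diameter involve uncountably many \<open>y\<close>, but both
  depend on the sample only through \<open>rounded n X\<close>, so \<open>measurable_rounded\<close>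
  settles them without inspecting them. This is valid also for those \<open>n\<close> for which no
  grid exists.\<close>

lemma random_band_lower_upper: "random_band T n (lower G n) (upper G n)"
  unfolding random_band_def
proof (intro conjI ballI allI impI)
  have real_valued: "(\<lambda>X. F (rounded n X)) \<in> borel_measurable (sample_space T n)"
    for F :: "_ \<Rightarrow> 'c::topological_space"
    by (rule measurable_compose[OF measurable_rounded]) simp
  show "(\<lambda>X. lower G n X y) \<in> borel_measurable (sample_space T n)" for y
    unfolding lower_def by (rule real_valued)
  show "(\<lambda>X. upper G n X y) \<in> borel_measurable (sample_space T n)" for y
    unfolding upper_def by (rule real_valued)
  show "lower G n X y \<le> upper G n X y" for X y
    using radius_const_nonneg rate_nonneg[of n] by (simp add: lower_def upper_def)
  show "band_diameter T (lower G n) (upper G n) \<in> borel_measurable (sample_space T n)"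
    unfolding band_diameter_def[abs_def] lower_def upper_def by (rule real_valued)
  have "cover_event T n (lower G n) (upper G n) f
     = {X \<in> space (sample_space T n). (\<lambda>x. \<forall>y\<in>T. f y \<in> {centre G n x y - radius_const * rate n (smoothness G n x)..
          centre G n x y + radius_const * rate n (smoothness G n x)}) (rounded n X)}" for f
    by (simp add: cover_event_def lower_def upper_def)
  also have "\<dots> f \<in> sets (sample_space T n)" for f
    using measurable_rounded by (rule predE[OF _])
  finally show "cover_event T n (lower G n) (upper G n) f \<in> sets (sample_space T n)" for f .
qed

lemma mesh:
  assumes n: "2 \<le> n" and X: "X \<in> space (sample_space T n)" and i: "i \<in> I" "2 ^ lev i \<le> real n / ln (real n)"
  shows "\<bar>empirical_coef n (rounded n X) i - empirical_coef n X i\<bar> \<le> noise n"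
proof -
  have "0 < noise n" using n noise_const_ge by (simp add: noise_def)
  from someI_ex[OF exists_mesh[OF this, of n "real n / ln (real n)"]] show ?thesis
    using X i unfolding mesh_def[symmetric] rounded_def by blast
qed

definition good :: "nat \<Rightarrow> (real \<Rightarrow> real) \<Rightarrow> (nat \<Rightarrow> real) \<Rightarrow> bool" where
  "good n f X \<longleftrightarrow> X \<in> space (sample_space T n) \<and>
     (\<forall>i\<in>I. 2 ^ lev i \<le> real n / ln (real n) \<longrightarrow> \<bar>empirical_coef n X i - coef f i\<bar> \<le> noise n)"

lemma good_feasible:
  assumes n: "2 \<le> n" and good: "good n f X" and f: "f \<in> H s"
  shows "feasible n (rounded n X) s f"
  unfolding feasible_def
proof (intro conjI ballI impI)
  fix i assume i: "i \<in> I" "2 ^ lev i \<le> real n / ln (real n)"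
  then have "\<bar>empirical_coef n X i - coef f i\<bar> \<le> noise n" using good by (auto simp: good_def)
  moreover have "\<bar>empirical_coef n (rounded n X) i - empirical_coef n X i\<bar> \<le> noise n"
    using good by (intro mesh[OF n _ i]) (auto simp: good_def)
  ultimately show "\<bar>empirical_coef n (rounded n X) i - coef f i\<bar> \<le> 2 * noise n" by linarith
qed (fact f)

text \<open>The triangle inequality through the empirical coefficients gives
  \<open>4 * noise n\<close> on coarse levels. With \<open>N = n / ln n\<close> this is a multiple
  of \<open>N powr (- 1 / 2)\<close>, and both terms of \<open>density_ball_close\<close> become
  multiples of the rate for the smaller index \<open>s\<close>.\<close>

lemma feasible_close:
  assumes n: "2 \<le> n" and f: "feasible n x s f" and g: "feasible n x t g" and s: "r \<le> s" "s \<le> t"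
    and y: "y \<in> T"
  shows "\<bar>f y - g y\<bar> \<le> radius_const * rate n s"
proof -
  define N where "N = real n / ln (real n)"
  have ln: "0 < ln (real n)" using n by simp
  have N: "1 \<le> N" using ln ln_le_minus_one[of "real n"] n by (simp add: N_def)
  have inv: "ln (real n) / real n = inverse N" using ln n by (simp add: N_def)
  have "\<bar>f y - g y\<bar> \<le> M * (4 * (4 * noise n) * N powr (1 / (2 * (2 * s + 1)))
    + 2 * B / (1 - 2 powr (- r)) * N powr (- s / (2 * s + 1)))"
  proof (rule density_ball_close[where f = f and g = g and x = y and s = s and t = t])
    show "f \<in> density_ball B s" using f H_ball s by (auto simp: feasible_def)
    show "g \<in> density_ball B t" using g H_ball[of t] s by (auto simp: feasible_def)
    show "0 \<le> 4 * noise n" using noise_const_ge ln by (simp add: noise_def)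
    show "\<bar>coef f i - coef g i\<bar> \<le> 4 * noise n" if i: "i \<in> I" "2 ^ lev i \<le> N" for i
    proof -
      have "\<bar>empirical_coef n x i - coef f i\<bar> \<le> 2 * noise n" "\<bar>empirical_coef n x i - coef g i\<bar> \<le> 2 * noise n"
        using f g i by (auto simp: feasible_def N_def)
      then show ?thesis by linarith
    qed
  qed (use s y N r_pos B_nonneg in auto)
  also have "N powr (- s / (2 * s + 1)) = rate n s"
    using N unfolding rate_def inv by (simp add: powr_minus inverse_powr)
  also have "4 * (4 * noise n) * N powr (1 / (2 * (2 * s + 1))) = 16 * noise_const B r * rate n s"
  proof -
    have "sqrt (inverse N) = N powr (- 1 / 2)"
      using N by (simp add: powr_half_sqrt[symmetric] powr_minus inverse_powr)
    moreover have "- 1 / 2 + 1 / (2 * (2 * s + 1)) = - s / (2 * s + 1)"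
      using s r_pos by (simp add: divide_simps)
    ultimately have "sqrt (inverse N) * N powr (1 / (2 * (2 * s + 1))) = N powr (- s / (2 * s + 1))"
      by (metis powr_add)
    moreover have "N powr (- s / (2 * s + 1)) = rate n s"
      using N unfolding rate_def inv by (simp add: powr_minus inverse_powr)
    ultimately show ?thesis by (simp add: noise_def inv)
  qed
  finally show ?thesis by (simp add: radius_const_def algebra_simps)
qed

lemma good_smoothness:
  assumes n: "2 \<le> n" and good: "good n f X" and f: "f \<in> H s"
    and G: "finite G" "G \<subseteq> {r..}" "s \<in> G" and L: "radius_const < L"
    and sep: "\<And>t. t \<in> G \<Longrightarrow> s < t \<Longrightarrow> ennreal (L * rate n s) \<le> (INF g\<in>H t. sup_norm_on T (\<lambda>x. g x - f x))"
  shows "smoothness G n (rounded n X) = s"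
proof -
  let ?x = "rounded n X"
  have fs: "feasible n ?x s f" by (rule good_feasible[OF n good f])
  have "t \<le> s" if t: "t \<in> G" "feasible n ?x t g" for t g
  proof (rule ccontr)
    assume "\<not> t \<le> s"
    then have "s < t" by simp
    have "ennreal (L * rate n s) \<le> (INF g\<in>H t. sup_norm_on T (\<lambda>x. g x - f x))"
      using sep t \<open>s < t\<close> by blast
    also have "\<dots> \<le> sup_norm_on T (\<lambda>x. g x - f x)"
      using t by (intro INF_lower) (auto simp: feasible_def)
    also have "\<dots> \<le> ennreal (radius_const * rate n s)"
      unfolding sup_norm_on_def using feasible_close[OF n fs t(2)] G \<open>s < t\<close>
      by (intro SUP_least ennreal_leI) (auto simp: abs_minus_commute)
    finally have "L * rate n s \<le> radius_const * rate n s"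
      using radius_const_nonneg rate_nonneg[of n s] by (simp add: ennreal_le_iff)
    \<comment> \<open>Strictness of \<open>radius_const < L\<close> counts because the rate is
      positive.\<close>
    then show False using L rate_pos[OF n, of s] by simp
  qed
  then have "Max {t\<in>G. \<exists>g. feasible n ?x t g} = s"
    using G fs by (intro Max_eqI) auto
  then show ?thesis using G fs by (auto simp: smoothness_def)
qed

lemma good_cover:
  assumes "2 \<le> n" "good n f X" "f \<in> H s" "finite G" "G \<subseteq> {r..}" "s \<in> G" "radius_const < L"
    and "\<And>t. t \<in> G \<Longrightarrow> s < t \<Longrightarrow> ennreal (L * rate n s) \<le> (INF g\<in>H t. sup_norm_on T (\<lambda>x. g x - f x))"
  shows "X \<in> cover_event T n (lower G n) (upper G n) f"
proof -
  let ?x = "rounded n X"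
  have sm: "smoothness G n ?x = s" by (rule good_smoothness) fact+
  have fs: "feasible n ?x s f" by (rule good_feasible) fact+
  then have "feasible n ?x s (centre G n ?x)"
    unfolding centre_def sm by (rule someI[of "feasible n ?x s" f])
  then have "\<bar>f y - centre G n ?x y\<bar> \<le> radius_const * rate n s" if "y \<in> T" for y
    using that assms fs by (intro feasible_close[where t = s]) auto
  then show ?thesis
    using assms(2) by (force simp: cover_event_def good_def lower_def upper_def sm abs_le_iff)
qed

lemma smoothness_ge: "finite G \<Longrightarrow> G \<subseteq> {r..} \<Longrightarrow> r \<le> smoothness G n x"
  using Max_in[of "{t\<in>G. \<exists>g. feasible n x t g}"] by (auto simp: smoothness_def)

lemma band_diameter_le:
  "band_diameter T (lower G n) (upper G n) X \<le> ennreal (2 * radius_const * rate n (smoothness G n (rounded n X)))"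
  unfolding band_diameter_def sup_norm_on_def
  using radius_const_nonneg rate_nonneg[of n] by (intro SUP_least ennreal_leI) (simp add: lower_def upper_def)

lemma good_event:
  assumes n: "2 \<le> n" and f: "f \<in> H s" and s: "r \<le> s"
  obtains Bad where "Bad \<in> sets (sample_space T n)" "measure (sample_law T f n) Bad \<le> 1 / real n"
    "\<And>X. X \<in> space (sample_space T n) - Bad \<Longrightarrow> good n f X"
proof -
  have "f \<in> density_ball B s" using f H_ball s by auto
  from empirical_deviation[OF this r_pos s B_nonneg n] show ?thesis
    using that unfolding good_def noise_def by (metis DiffD1)
qed

lemma coverage:
  assumes n: "2 \<le> n" and f: "f \<in> H s" and G: "finite G" "G \<subseteq> {r..}" "s \<in> G" and L: "radius_const < L"
    and sep: "\<And>t. t \<in> G \<Longrightarrow> s < t \<Longrightarrow> ennreal (L * rate n s) \<le> (INF g\<in>H t. sup_norm_on T (\<lambda>x. g x - f x))"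
  shows "1 - 1 / real n \<le> measure (sample_law T f n) (cover_event T n (lower G n) (upper G n) f)"
proof -
  have rs: "r \<le> s" using G by auto
  then have fb: "f \<in> density_ball B s" using f H_ball by auto
  interpret P: prob_space "sample_law T f n" using fb by (rule prob_space_sample_law)
  obtain Bad where Bad: "Bad \<in> sets (sample_space T n)" "measure (sample_law T f n) Bad \<le> 1 / real n"
    "\<And>X. X \<in> space (sample_space T n) - Bad \<Longrightarrow> good n f X"
    using good_event[OF n f rs] by blast
  have meas: "cover_event T n (lower G n) (upper G n) f \<in> P.events"
    using random_band_lower_upper fb unfolding sets_sample_law random_band_def by (auto simp: density_ball_def)
  have "1 - 1 / real n \<le> 1 - P.prob Bad" using Bad by simp
  also have "\<dots> = P.prob (space (sample_law T f n) - Bad)"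
    using Bad by (subst P.prob_compl) (auto simp: sets_sample_law)
  also have "\<dots> \<le> P.prob (cover_event T n (lower G n) (upper G n) f)"
    using good_cover[OF n Bad(3) f G L sep] meas
    by (intro P.finite_measure_mono) (auto simp: space_sample_law)
  finally show ?thesis .
qed

text \<open>Off the exceptional event the width is exactly of order \<open>rate n s\<close>. On it
  the width is at most \<open>2 * radius_const\<close>, as rates do not exceed 1, and the
  probability \<open>1 / n\<close> is at most \<open>rate n s\<close>; this doubles the factor 2 to
  4.\<close>

lemma expected_diameter:
  assumes n: "2 \<le> n" and f: "f \<in> H s" and G: "finite G" "G \<subseteq> {r..}" "s \<in> G" and L: "radius_const < L"
    and sep: "\<And>t. t \<in> G \<Longrightarrow> s < t \<Longrightarrow> ennreal (L * rate n s) \<le> (INF g\<in>H t. sup_norm_on T (\<lambda>x. g x - f x))"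
  shows "(\<integral>\<^sup>+X. band_diameter T (lower G n) (upper G n) X \<partial>sample_law T f n) \<le> ennreal (4 * radius_const * rate n s)"
proof -
  have rs: "r \<le> s" using G by auto
  then have fb: "f \<in> density_ball B s" using f H_ball by auto
  interpret P: prob_space "sample_law T f n" using fb by (rule prob_space_sample_law)
  obtain Bad where Bad: "Bad \<in> sets (sample_space T n)" "measure (sample_law T f n) Bad \<le> 1 / real n"
    "\<And>X. X \<in> space (sample_space T n) - Bad \<Longrightarrow> good n f X"
    using good_event[OF n f rs] by blast
  have Bad_ev: "Bad \<in> P.events" using Bad by (simp add: sets_sample_law)
  define a where "a = 2 * radius_const * rate n s"
  define b where "b = 2 * radius_const"
  have ab: "0 \<le> a" "0 \<le> b" using radius_const_nonneg rate_nonneg[of n s] by (auto simp: a_def b_def)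
  have "(\<integral>\<^sup>+X. band_diameter T (lower G n) (upper G n) X \<partial>sample_law T f n)
      \<le> (\<integral>\<^sup>+X. ennreal a + ennreal b * indicator Bad X \<partial>sample_law T f n)"
  proof (rule nn_integral_mono)
    fix X assume "X \<in> space (sample_law T f n)"
    then have X: "X \<in> space (sample_space T n)" by (simp add: space_sample_law)
    show "band_diameter T (lower G n) (upper G n) X \<le> ennreal a + ennreal b * indicator Bad X"
    proof (cases "X \<in> Bad")
      case True
      have "rate n (smoothness G n (rounded n X)) \<le> 1"
        using smoothness_ge[OF G(1,2), of n "rounded n X"] r_pos by (intro rate_le_1) auto
      then have "2 * radius_const * rate n (smoothness G n (rounded n X)) \<le> b"
        unfolding b_def using radius_const_nonneg by (intro mult_left_le) auto
      then have "band_diameter T (lower G n) (upper G n) X \<le> ennreal b"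
        by (intro order_trans[OF band_diameter_le] ennreal_leI)
      then show ?thesis using True by (simp add: add_increasing)
    next
      case False
      then have "smoothness G n (rounded n X) = s"
        using X by (intro good_smoothness[OF n Bad(3) f G L sep]) auto
      then show ?thesis using band_diameter_le[of G n X] False by (simp add: a_def)
    qed
  qed
  also have "\<dots> = ennreal a + ennreal b * emeasure (sample_law T f n) Bad"
    using Bad_ev by (subst nn_integral_add) (auto simp: nn_integral_cmult_indicator P.emeasure_space_1)
  also have "\<dots> = ennreal (a + b * P.prob Bad)"
    using ab by (simp add: P.emeasure_eq_measure ennreal_mult)
  also have "\<dots> \<le> ennreal (4 * radius_const * rate n s)"
  proof (rule ennreal_leI)
    have "P.prob Bad \<le> rate n s" using Bad(2) inverse_le_rate[OF n, of s] r_pos rs by linarith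
    then have "b * P.prob Bad \<le> b * rate n s" using ab by (intro mult_left_mono)
    then show "a + b * P.prob Bad \<le> 4 * radius_const * rate n s" by (simp add: a_def b_def mult.commute)
  qed
  finally show ?thesis .
qed

end

section \<open>Daubechies bases\<close>

text \<open>The conditions of \<open>localized_basis\<close> for a single level, checked separately
  for scaling functions and wavelets before they are merged.\<close>

definition tame :: "real set \<Rightarrow> 'k set \<Rightarrow> ('k \<Rightarrow> real \<Rightarrow> real) \<Rightarrow> real \<Rightarrow> bool" where
  "tame T K g C \<longleftrightarrow>
     (\<forall>x\<in>T. \<forall>F. finite F \<longrightarrow> F \<subseteq> K \<longrightarrow> (\<Sum>k\<in>F. \<bar>g k x\<bar>) \<le> C) \<and>
     (\<forall>\<delta>>0. \<exists>d>0. \<forall>k\<in>K. \<forall>x\<in>T. \<forall>y\<in>T. \<bar>x - y\<bar> < d \<longrightarrow> \<bar>g k x - g k y\<bar> \<le> \<delta>) \<and>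
     (\<forall>k\<in>K. set_integrable lborel T (g k))"

lemma times_cont_diff_on_continuous:
  assumes "times_cont_diff_on S A f" shows "continuous_on A f"
proof -
  obtain D where "\<forall>x\<in>A. D 0 x = f x" "continuous_on A (D (0::nat))"
    using assms unfolding times_cont_diff_on_def by auto
  then show ?thesis by (metis continuous_on_cong)
qed

lemma compact_support_bounded:
  fixes v :: "real \<Rightarrow> real"
  assumes "continuous_on {-A..A} v" and "\<And>x. x \<notin> {-A..A} \<Longrightarrow> v x = 0"
  obtains V where "0 \<le> V" "\<And>x. \<bar>v x\<bar> \<le> V"
proof -
  have "bounded (v ` {-A..A})"
    using assms(1) by (intro compact_imp_bounded compact_continuous_image) auto
  then obtain V where "\<forall>x\<in>{-A..A}. \<bar>v x\<bar> \<le> V" by (auto simp: bounded_iff)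
  then have "\<bar>v x\<bar> \<le> max 0 V" for x using assms(2)[of x] by (cases "x \<in> {-A..A}") (auto intro: max.coboundedI2)
  then show ?thesis using that[of "max 0 V"] by auto
qed

text \<open>Only the integers \<open>k\<close> within distance \<open>A\<close> of \<open>y\<close>
  contribute, and there are at most \<open>2 * A + 1\<close> of them wherever \<open>y\<close>
  lies.\<close>

lemma sum_translates_bounded:
  fixes v :: "real \<Rightarrow> real"
  assumes "continuous_on UNIV v" and "\<And>x. x \<notin> {-A..A} \<Longrightarrow> v x = 0" and "0 \<le> A"
  obtains C where "0 \<le> C" "\<And>y F. finite F \<Longrightarrow> (\<Sum>k\<in>F. \<bar>v (y - of_int k)\<bar>) \<le> C"
proof -
  obtain V where V: "0 \<le> V" "\<And>x. \<bar>v x\<bar> \<le> V"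
    using compact_support_bounded[of A v] assms by (metis continuous_on_subset subset_UNIV)
  have "(\<Sum>k\<in>F. \<bar>v (y - of_int k)\<bar>) \<le> (2 * A + 1) * V" if F: "finite F" for y and F :: "int set"
  proof -
    let ?R = "{\<lceil>y - A\<rceil>..\<lfloor>y + A\<rfloor>}"
    have "(\<Sum>k\<in>F. \<bar>v (y - of_int k)\<bar>) = (\<Sum>k\<in>F \<inter> ?R. \<bar>v (y - of_int k)\<bar>)"
    proof (rule sum.mono_neutral_right[OF F])
      show "\<forall>k\<in>F - F \<inter> ?R. \<bar>v (y - of_int k)\<bar> = 0"
      proof
        fix k assume "k \<in> F - F \<inter> ?R"
        then have "y - of_int k \<notin> {-A..A}" by (auto simp: ceiling_le_iff le_floor_iff)
        then show "\<bar>v (y - of_int k)\<bar> = 0" using assms(2) by simp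
      qed
    qed auto
    also have "\<dots> \<le> real (card (F \<inter> ?R)) * V" using V by (intro sum_bounded_above) auto
    also have "\<dots> \<le> (2 * A + 1) * V"
    proof (rule mult_right_mono)
      have "card (F \<inter> ?R) \<le> card ?R" by (intro card_mono) auto
      also have "\<dots> = nat (\<lfloor>y + A\<rfloor> + 1 - \<lceil>y - A\<rceil>)" by simp
      finally have "real (card (F \<inter> ?R)) \<le> real (nat (\<lfloor>y + A\<rfloor> + 1 - \<lceil>y - A\<rceil>))" by simp
      also have "\<dots> \<le> 2 * A + 1"
      proof -
        have "real_of_int \<lfloor>y + A\<rfloor> \<le> y + A" "y - A \<le> real_of_int \<lceil>y - A\<rceil>" by linarith+
        then have "real_of_int (\<lfloor>y + A\<rfloor> + 1 - \<lceil>y - A\<rceil>) \<le> 2 * A + 1"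
          unfolding of_int_diff of_int_add of_int_1 by linarith
        then show ?thesis using \<open>0 \<le> A\<close> by (cases "0 \<le> \<lfloor>y + A\<rfloor> + 1 - \<lceil>y - A\<rceil>") auto
      qed
      finally show "real (card (F \<inter> ?R)) \<le> 2 * A + 1" .
    qed (rule V)
    finally show ?thesis .
  qed
  then show ?thesis using that[of "(2 * A + 1) * V"] V assms(3) by auto
qed

lemma compact_support_uniformly_continuous:
  fixes v :: "real \<Rightarrow> real"
  assumes v: "continuous_on UNIV v" "\<And>x. x \<notin> {-A..A} \<Longrightarrow> v x = 0" and \<delta>: "0 < \<delta>"
  obtains d where "0 < d" "\<And>x y. \<bar>x - y\<bar> < d \<Longrightarrow> \<bar>v x - v y\<bar> \<le> \<delta>"
proof -
  \<comment> \<open>With distances below 1, two points of which one lies in the support interval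
    both lie in the enlarged one.\<close>
  have "uniformly_continuous_on {-A-1..A+1} v"
    using v by (intro compact_uniformly_continuous) (auto intro: continuous_on_subset)
  then obtain d where d: "0 < d" "\<And>x y. x \<in> {-A-1..A+1} \<Longrightarrow> y \<in> {-A-1..A+1} \<Longrightarrow> \<bar>y - x\<bar> < d \<Longrightarrow> \<bar>v y - v x\<bar> < \<delta>"
    unfolding uniformly_continuous_on_def dist_real_def using \<delta> by metis
  have "\<bar>v x - v y\<bar> \<le> \<delta>" if "\<bar>x - y\<bar> < min d 1" for x y
  proof (cases "x \<in> {-A..A} \<or> y \<in> {-A..A}")
    case True
    then have "x \<in> {-A-1..A+1}" "y \<in> {-A-1..A+1}" using that by auto
    then show ?thesis using d(2)[of y x] that by auto
  next
    case False
    then show ?thesis using v(2)[of x] v(2)[of y] \<delta> by auto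
  qed
  then show ?thesis using d(1) that[of "min d 1"] by auto
qed

text \<open>Translation does not change the modulus of continuity, so one \<open>d\<close> serves
  infinitely many \<open>k\<close>.\<close>

lemma tame_translates:
  fixes v :: "real \<Rightarrow> real"
  assumes v: "continuous_on UNIV v" "\<And>x. x \<notin> {-A..A} \<Longrightarrow> v x = 0"
    and C: "\<And>y F. finite F \<Longrightarrow> (\<Sum>k\<in>F. \<bar>v (y - of_int k)\<bar>) \<le> C"
    and ab: "0 < a" "0 < b"
  shows "tame UNIV K (\<lambda>k x. a * v (b * x - of_int k)) (a * C)"
  unfolding tame_def
proof (intro conjI ballI allI impI)
  show "(\<Sum>k\<in>F. \<bar>a * v (b * x - of_int k)\<bar>) \<le> a * C" if "finite F" for x F
    using mult_left_mono[OF C[OF that, of "b * x"], of a] ab by (simp add: abs_mult sum_distrib_left)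
  fix \<delta> :: real assume "0 < \<delta>"
  then obtain d where d: "0 < d" "\<And>x y. \<bar>x - y\<bar> < d \<Longrightarrow> \<bar>v x - v y\<bar> \<le> \<delta> / a"
    using compact_support_uniformly_continuous[OF v, of A "\<delta> / a"] ab by auto
  show "\<exists>d>0. \<forall>k\<in>K. \<forall>x\<in>UNIV. \<forall>y\<in>UNIV. \<bar>x - y\<bar> < d \<longrightarrow> \<bar>a * v (b * x - of_int k) - a * v (b * y - of_int k)\<bar> \<le> \<delta>"
  proof (intro exI[of _ "d / b"] conjI ballI impI)
    fix k :: int and x y assume "\<bar>x - y\<bar> < d / b"
    then have "b * \<bar>x - y\<bar> < d" using ab by (simp add: pos_less_divide_eq mult.commute)
    then have "\<bar>(b * x - of_int k) - (b * y - of_int k)\<bar> < d"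
      using ab by (simp add: abs_mult right_diff_distrib[symmetric])
    then have "\<bar>v (b * x - of_int k) - v (b * y - of_int k)\<bar> \<le> \<delta> / a" by (rule d)
    then have "a * \<bar>v (b * x - of_int k) - v (b * y - of_int k)\<bar> \<le> \<delta>"
      using ab by (simp add: pos_le_divide_eq mult.commute)
    then show "\<bar>a * v (b * x - of_int k) - a * v (b * y - of_int k)\<bar> \<le> \<delta>"
      using ab by (simp add: abs_mult right_diff_distrib[symmetric])
  qed (use d ab in auto)
next
  fix k :: int
  let ?f = "\<lambda>x. a * v (b * x - of_int k)"
  let ?J = "{(of_int k - A) / b..(of_int k + A) / b}"
  have "set_integrable lborel ?J ?f"
    by (intro borel_integrable_atLeastAtMost' continuous_intros continuous_on_compose2[OF v(1)]) auto
  moreover have "(\<lambda>x. indicat_real ?J x *\<^sub>R ?f x) = ?f"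
  proof
    fix x
    have "v (b * x - of_int k) = 0" if "x \<notin> ?J"
      using that ab by (intro v(2)) (auto simp: field_simps)
    then show "indicat_real ?J x *\<^sub>R ?f x = ?f x" by (auto simp: indicator_def)
  qed
  ultimately show "set_integrable lborel UNIV ?f" by (simp add: set_integrable_def)
qed

lemma tame_finite:
  assumes K: "finite K" and cont: "\<And>k. k \<in> K \<Longrightarrow> continuous_on {0..1} (g k)"
    and C: "\<And>x F. x \<in> {0..1} \<Longrightarrow> F \<subseteq> K \<Longrightarrow> (\<Sum>k\<in>F. \<bar>g k x\<bar>) \<le> C"
  shows "tame {0..1} K g C"
  unfolding tame_def
proof (intro conjI allI impI)
  fix \<delta> :: real assume \<delta>: "0 < \<delta>"
  show "\<exists>d>0. \<forall>k\<in>K. \<forall>x\<in>{0..1}. \<forall>y\<in>{0..1}. \<bar>x - y\<bar> < d \<longrightarrow> \<bar>g k x - g k y\<bar> \<le> \<delta>"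
    using K cont
  proof (induction K)
    case (insert k K)
    obtain d1 where d1: "d1 > 0" "\<forall>k\<in>K. \<forall>x\<in>{0..1}. \<forall>y\<in>{0..1}. \<bar>x - y\<bar> < d1 \<longrightarrow> \<bar>g k x - g k y\<bar> \<le> \<delta>"
      using insert.IH insert.prems by auto
    have "uniformly_continuous_on {0..1} (g k)"
      using insert.prems by (intro compact_uniformly_continuous) auto
    then obtain d2 where d2: "d2 > 0" "\<forall>x\<in>{0..1}. \<forall>y\<in>{0..1}. \<bar>y - x\<bar> < d2 \<longrightarrow> \<bar>g k y - g k x\<bar> < \<delta>"
      unfolding uniformly_continuous_on_def dist_real_def using \<delta> by metis
    show ?case
      using d1 d2 by (intro exI[of _ "min d1 d2"]) (auto simp: less_imp_le)
  qed (auto intro: exI[of _ 1])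
qed (use C cont in \<open>auto intro: borel_integrable_atLeastAtMost'\<close>)

lemma sqrt2_power: "2 powr (real l / 2) = sqrt 2 ^ l"
  by (simp add: powr_half_sqrt[symmetric] powr_realpow[symmetric] powr_powr)

lemma edge_funs_bounded:
  assumes "edge_funs S N g"
  obtains V where "0 \<le> V" "\<And>k x. k \<in> {0..<int N} \<Longrightarrow> 0 \<le> x \<Longrightarrow> \<bar>g k x\<bar> \<le> V"
proof -
  have "\<exists>V\<ge>0. \<forall>x\<ge>0. \<bar>g k x\<bar> \<le> V" if k: "k \<in> {0..<int N}" for k
  proof -
    have "continuous_on {0..} (g k)" and zero: "\<And>x. x > 2 * real N - 1 \<Longrightarrow> g k x = 0"
      using assms k times_cont_diff_on_continuous unfolding edge_funs_def by blast+
    then have "bounded (g k ` {0..2 * real N})"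
      by (intro compact_imp_bounded compact_continuous_image) (auto intro: continuous_on_subset)
    then obtain V where "\<forall>x\<in>{0..2 * real N}. \<bar>g k x\<bar> \<le> V" by (auto simp: bounded_iff)
    then have "\<bar>g k x\<bar> \<le> max 0 V" if "0 \<le> x" for x
      using zero[of x] that by (cases "x \<le> 2 * real N") (auto intro: max.coboundedI2)
    then show ?thesis by (intro exI[of _ "max 0 V"]) auto
  qed
  then obtain V where V: "\<And>k. k \<in> {0..<int N} \<Longrightarrow> 0 \<le> V k \<and> (\<forall>x\<ge>0. \<bar>g k x\<bar> \<le> V k)" by metis
  have "\<bar>g k x\<bar> \<le> (\<Sum>k\<in>{0..<int N}. V k)" if "k \<in> {0..<int N}" "0 \<le> x" for k x
    using V[OF that(1)] that V by (intro order_trans[OF _ member_le_sum[of k]]) auto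
  moreover have "0 \<le> (\<Sum>k\<in>{0..<int N}. V k)" using V by (intro sum_nonneg) auto
  ultimately show ?thesis using that by blast
qed

text \<open>The constant can be independent of \<open>l\<close>: at every level there are at most
  \<open>N\<close> edge functions at either end, with common bounds, and the interior ones are
  dilated translates of one function with bounded overlap.\<close>

lemma interval_fun_tame:
  assumes g: "continuous_on UNIV g" "\<And>x. x \<notin> {- real N..real N} \<Longrightarrow> g x = 0"
    and L: "edge_funs S N gL" and R: "edge_funs S N gR"
  obtains C where "0 \<le> C" "\<And>l. tame {0..1} {1..2 ^ l} (interval_fun N g gL gR l) (C * sqrt 2 ^ l)"
proof -
  obtain VL where VL: "0 \<le> VL" "\<And>k x. k \<in> {0..<int N} \<Longrightarrow> 0 \<le> x \<Longrightarrow> \<bar>gL k x\<bar> \<le> VL"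
    using edge_funs_bounded[OF L] by blast
  obtain VR where VR: "0 \<le> VR" "\<And>k x. k \<in> {0..<int N} \<Longrightarrow> 0 \<le> x \<Longrightarrow> \<bar>gR k x\<bar> \<le> VR"
    using edge_funs_bounded[OF R] by blast
  obtain C where C: "0 \<le> C" "\<And>y F. finite F \<Longrightarrow> (\<Sum>k\<in>F. \<bar>g (y - of_int k)\<bar>) \<le> C"
    using sum_translates_bounded[OF g of_nat_0_le_iff] by blast
  have edge: "continuous_on {0..} (gL k)" "continuous_on {0..} (gR k)" if "k \<in> {0..<int N}" for k
    using L R that times_cont_diff_on_continuous unfolding edge_funs_def by blast+
  define D where "D = real N * VL + C + real N * VR"
  have "tame {0..1} {1..2 ^ l} (interval_fun N g gL gR l) (D * sqrt 2 ^ l)" for l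
  proof (rule tame_finite)
    fix k :: int assume k: "k \<in> {1..2 ^ l}"
    consider "k \<le> int N" | "\<not> k \<le> int N" "k \<le> 2 ^ l - int N" | "\<not> k \<le> int N" "\<not> k \<le> 2 ^ l - int N" by blast
    then show "continuous_on {0..1} (interval_fun N g gL gR l k)"
    proof cases
      case 1
      then have "continuous_on {0..1} (\<lambda>x. gL (k - 1) (2 ^ l * x))"
        using k by (intro continuous_on_compose2[OF edge(1)] continuous_intros) auto
      then show ?thesis using 1 by (auto simp: interval_fun_def[abs_def] intro!: continuous_intros)
    next
      case 2
      have "continuous_on {0..1} (\<lambda>x. g (2 ^ l * x - of_int (k - 1)))"
        by (intro continuous_on_compose2[OF g(1)] continuous_intros) auto
      then show ?thesis using 2 by (auto simp: interval_fun_def[abs_def] intro!: continuous_intros)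
    next
      case 3
      then have "continuous_on {0..1} (\<lambda>x. gR (2 ^ l - k) (2 ^ l * (1 - x)))"
        using k by (intro continuous_on_compose2[OF edge(2)] continuous_intros) auto
      then show ?thesis using 3 by (auto simp: interval_fun_def[abs_def] intro!: continuous_intros)
    qed
  next
    fix x :: real and F :: "int set" assume x: "x \<in> {0..1}" and FK: "F \<subseteq> {1..2 ^ l}"
    then have F: "finite F" using finite_subset by blast
    define F1 where "F1 = {k\<in>F. k \<le> int N}"
    define F2 where "F2 = {k\<in>F. \<not> k \<le> int N \<and> k \<le> 2 ^ l - int N}"
    define F3 where "F3 = {k\<in>F. \<not> k \<le> int N \<and> \<not> k \<le> 2 ^ l - int N}"
    let ?i = "\<lambda>k. \<bar>interval_fun N g gL gR l k x\<bar>"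
    have fin: "finite F1" "finite F2" "finite F3" using F by (auto simp: F1_def F2_def F3_def)
    have F_eq: "F = F1 \<union> (F2 \<union> F3)" by (auto simp: F1_def F2_def F3_def)
    have "sum ?i (F1 \<union> (F2 \<union> F3)) = sum ?i F1 + sum ?i (F2 \<union> F3)"
      using fin by (intro sum.union_disjoint) (auto simp: F1_def F2_def F3_def)
    moreover have "sum ?i (F2 \<union> F3) = sum ?i F2 + sum ?i F3"
      using fin by (intro sum.union_disjoint) (auto simp: F2_def F3_def)
    ultimately have "(\<Sum>k\<in>F. ?i k) = (\<Sum>k\<in>F1. ?i k) + ((\<Sum>k\<in>F2. ?i k) + (\<Sum>k\<in>F3. ?i k))"
      using F_eq by simp
    also have "(\<Sum>k\<in>F1. ?i k) \<le> (\<Sum>k\<in>F1. sqrt 2 ^ l * VL)"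
    proof (rule sum_mono)
      fix k assume k: "k \<in> F1"
      then have "\<bar>gL (k - 1) (2 ^ l * x)\<bar> \<le> VL" using FK x by (intro VL) (auto simp: F1_def)
      then show "?i k \<le> sqrt 2 ^ l * VL"
        using k by (auto simp: F1_def interval_fun_def sqrt2_power abs_mult)
    qed
    also have "\<dots> \<le> real N * (sqrt 2 ^ l * VL)"
    proof -
      have "card F1 \<le> card {1..int N}" using FK by (intro card_mono) (auto simp: F1_def)
      then show ?thesis using VL by (simp add: mult_right_mono)
    qed
    also have "(\<Sum>k\<in>F2. ?i k) = sqrt 2 ^ l * (\<Sum>k\<in>F2. \<bar>g (2 ^ l * x - of_int (k - 1))\<bar>)"
      unfolding sum_distrib_left
      by (intro sum.cong) (auto simp: F2_def interval_fun_def sqrt2_power abs_mult)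
    also have "(\<Sum>k\<in>F2. \<bar>g (2 ^ l * x - of_int (k - 1))\<bar>) = (\<Sum>k\<in>(\<lambda>k. k - 1) ` F2. \<bar>g (2 ^ l * x - of_int k)\<bar>)"
      by (subst sum.reindex) (auto intro: inj_onI)
    also have "sqrt 2 ^ l * \<dots> \<le> sqrt 2 ^ l * C" using fin by (intro mult_left_mono C) auto
    also have "(\<Sum>k\<in>F3. ?i k) \<le> (\<Sum>k\<in>F3. sqrt 2 ^ l * VR)"
    proof (rule sum_mono)
      fix k assume k: "k \<in> F3"
      then have "\<bar>gR (2 ^ l - k) (2 ^ l * (1 - x))\<bar> \<le> VR" using FK x by (intro VR) (auto simp: F3_def)
      then show "?i k \<le> sqrt 2 ^ l * VR"
        using k by (auto simp: F3_def interval_fun_def sqrt2_power abs_mult)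
    qed
    also have "\<dots> \<le> real N * (sqrt 2 ^ l * VR)"
    proof -
      have "card F3 \<le> card {2 ^ l - int N<..2 ^ l}" using FK by (intro card_mono) (auto simp: F3_def)
      then show ?thesis using VR by (simp add: mult_right_mono)
    qed
    finally show "(\<Sum>k\<in>F. ?i k) \<le> D * sqrt 2 ^ l"
      by (simp add: D_def algebra_simps)
  qed auto
  then show ?thesis using that[of D] VL VR C by (auto simp: D_def)
qed

text \<open>The symmetric interval fits the lemmas on translates. For \<open>w\<close>, adding the
  ranges of \<open>k\<close> and of \<open>2 * x - k\<close> confines \<open>2 * x\<close> to
  [2 - 2N, 2N].\<close>

lemma daubechies_pair_support:
  assumes "daubechies_pair S N u w"
  shows "continuous_on UNIV u" "continuous_on UNIV w"
    "x \<notin> {- real N..real N} \<Longrightarrow> u x = 0" "x \<notin> {- real N..real N} \<Longrightarrow> w x = 0"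
proof -
  obtain h where u: "\<And>x. x \<notin> {1 - real N..real N} \<Longrightarrow> u x = 0"
    and w: "\<And>x. w x = sqrt 2 * (\<Sum>k\<in>{1 - int N..int N}. (-1) powi k * h (1 - k) * u (2 * x - of_int k))"
    and c: "times_cont_diff_on S UNIV u" "times_cont_diff_on S UNIV w"
    using assms unfolding daubechies_pair_def by blast
  show "continuous_on UNIV u" "continuous_on UNIV w" using c by (auto dest: times_cont_diff_on_continuous)
  show "x \<notin> {- real N..real N} \<Longrightarrow> u x = 0" by (rule u) auto
  assume x: "x \<notin> {- real N..real N}"
  have "u (2 * x - of_int k) = 0" if k: "k \<in> {1 - int N..int N}" for k
  proof (rule u)
    have "1 - real N \<le> of_int k" "of_int k \<le> real N" using k by auto
    then show "2 * x - of_int k \<notin> {1 - real N..real N}" using x by auto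
  qed
  then show "w x = 0" by (simp add: w)
qed

text \<open>Scaling functions get level 0 even if \<open>base_level\<close> is positive: their
  coefficients carry no weight in the Holder norm, and they are among the coarse indices as soon as
  \<open>1 \<le> n / ln n\<close>.\<close>

abbreviation system_level :: "int + nat \<times> int \<Rightarrow> nat" where
  "system_level \<equiv> case_sum (\<lambda>_. 0) fst"

lemma localized_basis_of_tame:
  assumes T: "T = UNIV \<or> T = {0..1}" and basis: "orthonormal_basis_on T (system_index W) (system_fun W)"
    and scal: "tame T (scal_ix W) (scal W) C0" and C: "0 \<le> C"
    and wav: "\<And>l. base_level W \<le> l \<Longrightarrow> tame T (wav_ix W l) (wav W l) (C * sqrt 2 ^ l)"
    and M: "max 1 (\<bar>C0\<bar> + C) \<le> M"
  shows "localized_basis T (system_index W) (system_fun W) system_level M"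
proof
  show "countable (system_index W)" by simp
  show "set_integrable lborel T (system_fun W i)" if "i \<in> system_index W" for i
    using that scal wav by (auto simp: system_index_def system_fun_def tame_def)
  show "1 \<le> M" using M by simp
  show "(\<Sum>i\<in>F. \<bar>system_fun W i x\<bar>) \<le> M * sqrt 2 ^ l"
    if x: "x \<in> T" and F: "finite F" "F \<subseteq> {i \<in> system_index W. system_level i = l}" for x l F
  proof -
    define F1 where "F1 = Inl -` F"
    define F2 where "F2 = {k. Inr (l, k) \<in> F}"
    have FU: "F = Inl ` F1 \<union> (\<lambda>k. Inr (l, k)) ` F2"
    proof (intro set_eqI iffI)
      fix i assume "i \<in> F"
      then show "i \<in> Inl ` F1 \<union> (\<lambda>k. Inr (l, k)) ` F2"
        using F by (cases i) (auto simp: F1_def F2_def)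
    qed (auto simp: F1_def F2_def)
    have fin: "finite F1" "finite F2"
      using F(1) unfolding F1_def F2_def
      by (auto intro!: finite_vimageI finite_inverse_image[of F "\<lambda>k. Inr (l, k)"] simp: inj_on_def)
    have "(\<Sum>i\<in>F. \<bar>system_fun W i x\<bar>) = (\<Sum>k\<in>F1. \<bar>scal W k x\<bar>) + (\<Sum>k\<in>F2. \<bar>wav W l k x\<bar>)"
      unfolding FU using fin
      by (subst sum.union_disjoint) (auto simp: sum.reindex inj_on_def system_fun_def)
    also have "(\<Sum>k\<in>F1. \<bar>scal W k x\<bar>) \<le> \<bar>C0\<bar> * sqrt 2 ^ l"
    proof -
      have "F1 \<subseteq> scal_ix W" using F by (auto simp: F1_def system_index_def)
      then have "(\<Sum>k\<in>F1. \<bar>scal W k x\<bar>) \<le> C0" using scal x fin unfolding tame_def by blast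
      also have "\<dots> \<le> \<bar>C0\<bar> * 1" by simp
      also have "\<dots> \<le> \<bar>C0\<bar> * sqrt 2 ^ l" by (intro mult_left_mono) auto
      finally show ?thesis .
    qed
    also have "(\<Sum>k\<in>F2. \<bar>wav W l k x\<bar>) \<le> C * sqrt 2 ^ l"
    proof (cases "F2 = {}")
      case False
      then have "base_level W \<le> l" "F2 \<subseteq> wav_ix W l" using F by (auto simp: F2_def system_index_def)
      then show ?thesis using wav[of l] x fin unfolding tame_def by blast
    qed (use C in simp)
    also have "\<bar>C0\<bar> * sqrt 2 ^ l + C * sqrt 2 ^ l = (\<bar>C0\<bar> + C) * sqrt 2 ^ l" by (simp add: algebra_simps)
    also have "\<dots> \<le> M * sqrt 2 ^ l" using M by (intro mult_right_mono) auto
    finally show ?thesis by simp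
  qed
  show "\<exists>d>0. \<forall>i\<in>system_index W. system_level i = l \<longrightarrow>
      (\<forall>x\<in>T. \<forall>y\<in>T. \<bar>x - y\<bar> < d \<longrightarrow> \<bar>system_fun W i x - system_fun W i y\<bar> \<le> \<delta>)" if \<delta>: "0 < \<delta>" for l \<delta>
  proof -
    obtain d1 where d1: "d1 > 0" "\<forall>k\<in>scal_ix W. \<forall>x\<in>T. \<forall>y\<in>T. \<bar>x - y\<bar> < d1 \<longrightarrow> \<bar>scal W k x - scal W k y\<bar> \<le> \<delta>"
      using scal \<delta> unfolding tame_def by blast
    obtain d2 where d2: "d2 > 0" "base_level W \<le> l \<Longrightarrow>
        \<forall>k\<in>wav_ix W l. \<forall>x\<in>T. \<forall>y\<in>T. \<bar>x - y\<bar> < d2 \<longrightarrow> \<bar>wav W l k x - wav W l k y\<bar> \<le> \<delta>"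
    proof (cases "base_level W \<le> l")
      case True
      then show ?thesis using wav[OF True] \<delta> that unfolding tame_def by blast
    qed (auto intro: that[of 1])
    show ?thesis
      using d1 d2 by (intro exI[of _ "min d1 d2"]) (auto simp: system_index_def system_fun_def)
  qed
qed (fact T basis)+

lemma daubechies_localized_basis:
  assumes "daubechies_basis S T W"
  obtains M where "localized_basis T (system_index W) (system_fun W) system_level M"
proof -
  consider "T = UNIV" "daubechies_basis_line S W" | "T = {0..1}" "daubechies_basis_interval S W"
    using assms unfolding daubechies_basis_def by blast
  then show thesis
  proof cases
    case 1
    then obtain N u w where p: "daubechies_pair S N u w"
      and W: "\<And>k x. scal W k x = u (x - of_int k)"
        "\<And>l k x. wav W l k x = 2 powr (real l / 2) * w (2 ^ l * x - of_int k)"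
      and basis: "orthonormal_basis_on UNIV (system_index W) (system_fun W)"
      unfolding daubechies_basis_line_def by blast
    note s = daubechies_pair_support[OF p]
    obtain C0 where C0: "0 \<le> C0" "\<And>y F. finite F \<Longrightarrow> (\<Sum>k\<in>F. \<bar>u (y - of_int k)\<bar>) \<le> C0"
      using sum_translates_bounded[OF s(1,3) of_nat_0_le_iff] by blast
    obtain C where C: "0 \<le> C" "\<And>y F. finite F \<Longrightarrow> (\<Sum>k\<in>F. \<bar>w (y - of_int k)\<bar>) \<le> C"
      using sum_translates_bounded[OF s(2,4) of_nat_0_le_iff] by blast
    have scal: "scal W = (\<lambda>k x. 1 * u (1 * x - of_int k))" by (simp add: W fun_eq_iff)
    have wav: "wav W l = (\<lambda>k x. sqrt 2 ^ l * w (2 ^ l * x - of_int k))" for l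
      by (simp add: W fun_eq_iff sqrt2_power)
    have "tame UNIV (scal_ix W) (scal W) C0"
      unfolding scal using tame_translates[OF s(1,3) C0(2), where a = 1 and b = 1 and K = "scal_ix W"] by simp
    moreover have "tame UNIV (wav_ix W l) (wav W l) (C * sqrt 2 ^ l)" for l
      unfolding wav mult.commute[of C] by (rule tame_translates[OF s(2,4) C(2)]) auto
    ultimately show thesis
      using that localized_basis_of_tame[OF _ basis _ C(1) _ order.refl, of C0] 1 by auto
  next
    case 2
    then obtain N u w uL uR wL wR where p: "daubechies_pair S N u w"
      and W: "\<forall>k x. scal W k x = interval_fun N u uL uR (base_level W) k x"
        "\<forall>l k x. wav W l k x = interval_fun N w wL wR l k x"
      and e: "edge_funs S N uL" "edge_funs S N uR" "edge_funs S N wL" "edge_funs S N wR"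
      and ix: "scal_ix W = {1..2 ^ base_level W}" "\<forall>l. wav_ix W l = {1..2 ^ l}"
      and basis: "orthonormal_basis_on {0..1} (system_index W) (system_fun W)"
      unfolding daubechies_basis_interval_def by (elim exE conjE) (rule that; assumption)
    note s = daubechies_pair_support[OF p]
    obtain C0 where C0: "0 \<le> C0" "\<And>l. tame {0..1} {1..2 ^ l} (interval_fun N u uL uR l) (C0 * sqrt 2 ^ l)"
      using interval_fun_tame[OF s(1,3) e(1,2)] by blast
    obtain C where C: "0 \<le> C" "\<And>l. tame {0..1} {1..2 ^ l} (interval_fun N w wL wR l) (C * sqrt 2 ^ l)"
      using interval_fun_tame[OF s(2,4) e(3,4)] by blast
    have scal: "scal W = interval_fun N u uL uR (base_level W)" by (simp add: W fun_eq_iff)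
    have wav: "wav W l = interval_fun N w wL wR l" for l by (simp add: W fun_eq_iff)
    \<comment> \<open>Their true size of order \<open>sqrt 2 ^ base_level W\<close> is absorbed into
      the constant, as they are filed under level 0.\<close>
    have "tame {0..1} (scal_ix W) (scal W) (C0 * sqrt 2 ^ base_level W)"
      unfolding scal ix(1) by (rule C0)
    moreover have "tame {0..1} (wav_ix W l) (wav W l) (C * sqrt 2 ^ l)" for l
      unfolding wav ix(2)[rule_format] by (rule C)
    ultimately show thesis
      using that localized_basis_of_tame[OF _ basis _ C(1) _ order.refl] 2 by blast
  qed
qed

section \<open>Adaptation over the grid\<close>

lemma holder_ball_subset:
  assumes lb: "localized_basis T (system_index W) (system_fun W) system_level M" and B: "0 \<le> B"
  shows "holder_ball W T B s \<subseteq> localized_basis.density_ball T (system_index W) (system_fun W) system_level B s"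
proof
  interpret localized_basis T "system_index W" "system_fun W" system_level M by (rule lb)
  fix f assume f: "f \<in> holder_ball W T B s"
  then have norm: "holder_norm W T s f \<le> ennreal B" by (simp add: holder_ball_def)
  have "\<bar>coef f i\<bar> \<le> B * 2 powr (- (real (system_level i) * (s + 1 / 2)))" if i: "i \<in> system_index W" for i
  proof (cases i)
    case (Inl k)
    then have k: "k \<in> scal_ix W" using i by (auto simp: system_index_def)
    have "ennreal \<bar>LINT x:T|lborel. f x * scal W k x\<bar>
        \<le> (SUP k\<in>scal_ix W. ennreal \<bar>LINT x:T|lborel. f x * scal W k x\<bar>)"
      by (rule SUP_upper[OF k])
    also have "\<dots> \<le> ennreal B" using norm unfolding holder_norm_def by simp
    finally have "\<bar>LINT x:T|lborel. f x * scal W k x\<bar> \<le> B" using B by simp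
    moreover have "coef f i = (LINT x:T|lborel. f x * scal W k x)"
      unfolding coef_def by (simp add: Inl system_fun_def)
    ultimately show ?thesis by (simp add: Inl)
  next
    case (Inr p)
    obtain l k where p: "p = (l, k)" by (cases p)
    then have lk: "l \<in> {base_level W..}" "k \<in> wav_ix W l" using i Inr by (auto simp: system_index_def)
    let ?c = "LINT x:T|lborel. f x * wav W l k x"
    have "ennreal (2 powr (real l * (s + 1 / 2)) * \<bar>?c\<bar>)
        \<le> (SUP k\<in>wav_ix W l. ennreal (2 powr (real l * (s + 1 / 2)) * \<bar>LINT x:T|lborel. f x * wav W l k x\<bar>))"
      by (rule SUP_upper[OF lk(2)])
    also have "\<dots> \<le> (SUP l\<in>{base_level W..}. SUP k\<in>wav_ix W l.
        ennreal (2 powr (real l * (s + 1 / 2)) * \<bar>LINT x:T|lborel. f x * wav W l k x\<bar>))"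
      by (rule SUP_upper[OF lk(1)])
    also have "\<dots> \<le> ennreal B" using norm unfolding holder_norm_def by simp
    finally have "2 powr (real l * (s + 1 / 2)) * \<bar>?c\<bar> \<le> B" using B by simp
    then have "\<bar>?c\<bar> \<le> B * 2 powr (- (real l * (s + 1 / 2)))"
      by (simp add: powr_minus field_simps)
    moreover have "coef f i = ?c"
      unfolding coef_def by (simp add: Inr p system_fun_def)
    ultimately show ?thesis by (simp add: Inr p)
  qed
  then show "f \<in> density_ball B s" using f by (simp add: density_ball_def holder_ball_def)
qed

lemma is_grid_finite: "is_grid \<zeta> r R n G \<Longrightarrow> finite G"
  by (auto simp: is_grid_def)

text \<open>Equispaced points work. If \<open>q\<close> is the length of [r, R] in units of \<zeta>
  / ln n and \<open>q \<ge> 1\<close>, then dividing into \<lfloor>q\<rfloor> steps makes each step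
  q / \<lfloor>q\<rfloor> units long, which lies between 1 and 2.\<close>

lemma eventually_is_grid_exists:
  assumes "r < R" "0 < \<zeta>"
  shows "\<forall>\<^sub>F n in sequentially. \<exists>A. is_grid \<zeta> r R n A"
proof -
  have "filterlim (\<lambda>n. ln (real n)) at_top sequentially"
    by (rule filterlim_compose[OF ln_at_top filterlim_real_sequentially])
  then have "\<forall>\<^sub>F n in sequentially. max 1 (\<zeta> / (R - r)) \<le> ln (real n)"
    unfolding filterlim_at_top by blast
  then show ?thesis
  proof eventually_elim
    case (elim n)
    then have ln: "0 < ln (real n)" "\<zeta> / (R - r) \<le> ln (real n)" by auto
    define q where "q = (R - r) * ln (real n) / \<zeta>"
    have q: "1 \<le> q" using ln assms by (simp add: q_def field_simps)
    define K where "K = nat \<lfloor>q\<rfloor>"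
    have "real K = of_int \<lfloor>q\<rfloor>" using q by (simp add: K_def)
    then have K: "real K \<le> q" "q < real K + 1" "1 \<le> K"
      using q by (auto simp: K_def le_nat_iff le_floor_iff)
    then have K2: "q \<le> 2 * real K" by linarith
    define d where "d = (R - r) / real K"
    have d: "0 < d" "real K * d = R - r" using K assms by (auto simp: d_def)
    have d_eq: "d = \<zeta> / ln (real n) * (q / real K)" using assms ln K by (simp add: d_def q_def)
    have "1 \<le> q / real K" "q / real K \<le> 2" using K K2 by (auto simp: divide_simps)
    then have dl: "\<zeta> / ln (real n) \<le> d" "d \<le> 2 * \<zeta> / ln (real n)"
      unfolding d_eq using assms ln mult_left_mono[of 1 "q / real K" "\<zeta> / ln (real n)"]
        mult_left_mono[of "q / real K" 2 "\<zeta> / ln (real n)"] by (auto simp: mult.commute)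
    define \<sigma> where "\<sigma> i = r + (real i - 1) * d" for i :: nat
    have \<sigma>: "\<sigma> i \<in> {r..R}" if "i \<in> {1..K + 1}" for i
    proof -
      have "0 \<le> (real i - 1) * d" using that d by simp
      moreover have "(real i - 1) * d \<le> real K * d" using that d by (intro mult_right_mono) auto
      ultimately show ?thesis using d by (simp add: \<sigma>_def)
    qed
    have "is_grid \<zeta> r R n (\<sigma> ` {1..K + 1})"
      unfolding is_grid_def
    proof (intro conjI exI[of _ "K + 1"] exI[of _ \<sigma>] ballI)
      fix i
      have "\<sigma> (i + 1) - \<sigma> i = d" by (simp add: \<sigma>_def algebra_simps)
      then show "\<sigma> i < \<sigma> (i + 1)" "\<zeta> / ln (real n) \<le> \<sigma> (i + 1) - \<sigma> i" "\<sigma> (i + 1) - \<sigma> i \<le> 2 * \<zeta> / ln (real n)"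
        using d dl by auto
    qed (use \<sigma> d in \<open>auto simp: \<sigma>_def\<close>)
    then show ?case by blast
  qed
qed

theorem theorem4:
  fixes T :: "real set" and W :: wavelet_system and S :: nat and r B :: real
  assumes basis: "daubechies_basis S T W"
    and r_pos: "0 < r"
    and B_ge: "1 \<le> B"
  shows "\<exists>L>0. \<forall>(R::real) (\<zeta>::real) (\<alpha>::real) (G :: nat \<Rightarrow> real set).
     r < R \<and> R < real S \<and> 0 < \<zeta> \<and> 0 < \<alpha> \<and> \<alpha> < 1 \<and>
     (\<forall>n\<ge>2. (\<exists>A. is_grid \<zeta> r R n A) \<longrightarrow> is_grid \<zeta> r R n (G n)) \<longrightarrow>
     (\<exists>c c' :: nat \<Rightarrow> (nat \<Rightarrow> real) \<Rightarrow> real \<Rightarrow> real.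
        (\<forall>n. random_band T n (c n) (c' n)) \<and>
        (\<forall>L0\<ge>L.
           liminf (\<lambda>n. INF f\<in>separated_union W T B R (G n) L0 n.
              ereal (measure (sample_law T f n) (cover_event T n (c n) (c' n) f))) \<ge> ereal (1 - \<alpha>) \<and>
           (\<exists>L'>0. \<forall>n\<ge>2. is_grid \<zeta> r R n (G n) \<longrightarrow>
              (\<forall>s\<in>G n.
                 (SUP f\<in>separated_class W T B R (G n) L0 n s.
                    \<integral>\<^sup>+X. band_diameter T (c n) (c' n) X \<partial>sample_law T f n)
                 \<le> ennreal (L' * rate n s)))))"
proof -
  obtain M where lb: "localized_basis T (system_index W) (system_fun W) system_level M"
    using daubechies_localized_basis[OF basis] .
  interpret localized_basis T "system_index W" "system_fun W" system_level M by (rule lb)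
  interpret band_construction T "system_index W" "system_fun W" system_level M "holder_ball W T B" B r
    using r_pos B_ge holder_ball_subset[OF lb] by unfold_locales auto
  show ?thesis
  \<comment> \<open>Any constant above \<open>radius_const\<close> separates. This one is determined
    by the basis, \<open>B\<close> and \<open>r\<close>, so it can be fixed before \<open>R\<close>,
    \<zeta>, \<alpha> and the grids.\<close>
  proof (intro exI[of _ "radius_const + 1"] conjI allI impI; (elim conjE)?)
    show "0 < radius_const + 1" using radius_const_nonneg by simp
    fix R \<zeta> \<alpha> :: real and G :: "nat \<Rightarrow> real set"
    assume par: "r < R" "0 < \<zeta>" "0 < \<alpha>"
      and G: "\<forall>n\<ge>2. (\<exists>A. is_grid \<zeta> r R n A) \<longrightarrow> is_grid \<zeta> r R n (G n)"
    \<comment> \<open>For \<open>s = R\<close> the separation property is vacuous, since no grid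
      point exceeds \<open>R\<close>; this case is thereby treated like the others.\<close>
    have sep: "f \<in> holder_ball W T B s"
        "t \<in> G n \<Longrightarrow> s < t \<Longrightarrow> ennreal (L0 * rate n s) \<le> (INF g\<in>holder_ball W T B t. sup_norm_on T (\<lambda>x. g x - f x))"
      if "is_grid \<zeta> r R n (G n)" "f \<in> separated_class W T B R (G n) L0 n s" for f s t n L0
      using that by (auto simp: separated_class_def is_grid_def split: if_splits)
    have grid: "finite (G n)" "G n \<subseteq> {r..}" if "is_grid \<zeta> r R n (G n)" for n
      using that is_grid_finite by (auto simp: is_grid_def)
    show "\<exists>c c' :: nat \<Rightarrow> (nat \<Rightarrow> real) \<Rightarrow> real \<Rightarrow> real.
        (\<forall>n. random_band T n (c n) (c' n)) \<and>
        (\<forall>L0\<ge>radius_const + 1.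
           liminf (\<lambda>n. INF f\<in>separated_union W T B R (G n) L0 n.
              ereal (measure (sample_law T f n) (cover_event T n (c n) (c' n) f))) \<ge> ereal (1 - \<alpha>) \<and>
           (\<exists>L'>0. \<forall>n\<ge>2. is_grid \<zeta> r R n (G n) \<longrightarrow>
              (\<forall>s\<in>G n.
                 (SUP f\<in>separated_class W T B R (G n) L0 n s.
                    \<integral>\<^sup>+X. band_diameter T (c n) (c' n) X \<partial>sample_law T f n)
                 \<le> ennreal (L' * rate n s))))"
    proof (rule exI[of _ "\<lambda>n. lower (G n) n"], rule exI[of _ "\<lambda>n. upper (G n) n"], intro conjI allI impI)
      show "random_band T n (lower (G n) n) (upper (G n) n)" for n by (rule random_band_lower_upper)
      fix L0 assume "radius_const + 1 \<le> L0"
      then have L0: "radius_const < L0" by simp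
      \<comment> \<open>Here \<alpha> only determines how large \<open>n\<close> must be for
        \<open>1 / n \<le> \<alpha>\<close>.\<close>
      have "\<forall>\<^sub>F n in sequentially. ereal (1 - \<alpha>) \<le> (INF f\<in>separated_union W T B R (G n) L0 n.
              ereal (measure (sample_law T f n) (cover_event T n (lower (G n) n) (upper (G n) n) f)))"
        using eventually_is_grid_exists[OF par(1,2)] eventually_ge_at_top[of 2]
          eventually_ge_at_top[of "nat \<lceil>1 / \<alpha>\<rceil>"]
      proof eventually_elim
        case (elim n)
        then have n: "2 \<le> n" and g: "is_grid \<zeta> r R n (G n)" using G by auto
        have "1 / \<alpha> \<le> real n" using elim(3) by (simp add: nat_le_iff ceiling_le_iff)
        then have "1 / real n \<le> \<alpha>" using par n by (simp add: field_simps)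
        show ?case
        proof (rule INF_greatest)
          fix f assume "f \<in> separated_union W T B R (G n) L0 n"
          then obtain s where s: "s \<in> G n" "f \<in> separated_class W T B R (G n) L0 n s"
            by (auto simp: separated_union_def)
          have "1 - 1 / real n \<le> measure (sample_law T f n) (cover_event T n (lower (G n) n) (upper (G n) n) f)"
            using sep[OF g s(2)] by (intro coverage[OF n _ grid[OF g] s(1) L0]) auto
          then show "ereal (1 - \<alpha>) \<le> ereal (measure (sample_law T f n) (cover_event T n (lower (G n) n) (upper (G n) n) f))"
            using \<open>1 / real n \<le> \<alpha>\<close> by simp
        qed
      qed
      then show "ereal (1 - \<alpha>) \<le> liminf (\<lambda>n. INF f\<in>separated_union W T B R (G n) L0 n.
              ereal (measure (sample_law T f n) (cover_event T n (lower (G n) n) (upper (G n) n) f)))"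
        by (rule Liminf_bounded)
      show "\<exists>L'>0. \<forall>n\<ge>2. is_grid \<zeta> r R n (G n) \<longrightarrow>
              (\<forall>s\<in>G n.
                 (SUP f\<in>separated_class W T B R (G n) L0 n s.
                    \<integral>\<^sup>+X. band_diameter T (lower (G n) n) (upper (G n) n) X \<partial>sample_law T f n)
                 \<le> ennreal (L' * rate n s))"
      \<comment> \<open>Adding 1 merely secures positivity of the constant.\<close>
      proof (intro exI[of _ "4 * radius_const + 1"] conjI allI impI ballI SUP_least)
        show "0 < 4 * radius_const + 1" using radius_const_nonneg by simp
        fix n s f assume n: "2 \<le> n" and g: "is_grid \<zeta> r R n (G n)" and s: "s \<in> G n"
          and f: "f \<in> separated_class W T B R (G n) L0 n s"
        have "(\<integral>\<^sup>+X. band_diameter T (lower (G n) n) (upper (G n) n) X \<partial>sample_law T f n)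
            \<le> ennreal (4 * radius_const * rate n s)"
          using sep[OF g f] by (intro expected_diameter[OF n _ grid[OF g] s L0]) auto
        also have "\<dots> \<le> ennreal ((4 * radius_const + 1) * rate n s)"
          using rate_nonneg[of n s] by (intro ennreal_leI mult_right_mono) auto
        finally show "(\<integral>\<^sup>+X. band_diameter T (lower (G n) n) (upper (G n) n) X \<partial>sample_law T f n)
            \<le> ennreal ((4 * radius_const + 1) * rate n s)" .
      qed
    qed
  qed
qed

end
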